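(* There exist a real-valued function $f\in\bigcap_{1\le p<\infty}L^p(\mathbb T)$ with $\int_{\mathbb T} f=0$ and an increasing sequence of positive integers $(n_j)_{j\ge1}$ with $n_{j+1}/n_j\ge2$ for all $j$ such that $$\|f-S_Nf\|_2\ll (\log\log N)^{-1/2}$$ for all sufficiently large $N$, while $$\limsup_{N\to\infty}\frac1N\sum_{j\le N}f(n_jx)=+\infty$$ for almost every $x\in\mathbb T$.
   Context: $\mathbb T=\mathbb R/\mathbb Z$ with normalized Lebesgue measure; $\|\cdot\|_2$ is the $L^2(\mathbb T)$ norm. For $f\in L^2(\mathbb T)$, $S_Nf(x)=\sum_{|m|\le N}\widehat f(m)e^{2\pi i m x}$ is the symmetric Fourier partial sum. $A(N)\ll B(N)$ means $A(N)\le C\,B(N)$ for some constant $C>0$ independent of $N$. *)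

theory Defs
  imports "HOL-Analysis.Analysis"
begin

(* Functions on T = R/Z are represented by their 1-periodic lifts to the real line;
   the normalized Lebesgue measure on T is Lebesgue measure on the fundamental domain [0,1). *)

definition one_periodic :: "(real \<Rightarrow> 'a) \<Rightarrow> bool" where
  "one_periodic f \<longleftrightarrow> (\<forall>x. f (x + 1) = f x)"

definition torus_measure :: "real measure" where
  "torus_measure = lebesgue_on {0..<1}"

definition in_Lp :: "real \<Rightarrow> (real \<Rightarrow> 'a::real_normed_vector) \<Rightarrow> bool" where
  "in_Lp p f \<longleftrightarrow> one_periodic f \<and> f \<in> borel_measurable torus_measure
     \<and> integrable torus_measure (\<lambda>x. norm (f x) powr p)"

(* Meaningful for square-integrable functions only: the Bochner integral
   of a non-integrable function is 0. *)
definition L2_norm :: "(real \<Rightarrow> 'a::real_normed_vector) \<Rightarrow> real" where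
  "L2_norm f = sqrt (LINT x|torus_measure. (norm (f x))\<^sup>2)"

definition fourier_coeff :: "(real \<Rightarrow> complex) \<Rightarrow> int \<Rightarrow> complex" where
  "fourier_coeff f m =
     (LINT x|torus_measure. f x * exp (- (2 * of_real pi * \<i> * of_int m * of_real x)))"

definition fourier_partial_sum :: "nat \<Rightarrow> (real \<Rightarrow> complex) \<Rightarrow> real \<Rightarrow> complex" where
  "fourier_partial_sum N f x =
     (\<Sum>m | \<bar>m\<bar> \<le> int N. fourier_coeff f m * exp (2 * of_real pi * \<i> * of_int m * of_real x))"

end

(* Spike functions on sparse digit events.  Let E_k be the event that one of the first M_k blocks of
   q_k binary digits of x vanishes, with M_k = 2^(2^(k+1)) and q_k chosen such that E_k has measure
   at most 2^(-k) / (k+1), up to a factor 2.  The function f = sum_k sqrt(k+1) (1_{E_k} - |E_k|) is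
   bounded below, and since E_k is a union of dyadic intervals of length exp(-exp(O(2^k))), its
   Fourier tail beyond N is governed by the spikes with 2^k of order at least log log N, which
   have squared norm of order 2^(-k).

   A shift by j <= M_k / 2 digit blocks moves E_k very little, so for n_j = 2^(s + q_k j) with
   2^r < j <= 2^(r+1) <= M_k all the f(n_j x) are large together, with probability of order |E_k|.
   This is repeated for the 2^k values of r with 2^k <= r + 1 < 2^(k+1), with fresh digits each time.
   The probabilities then sum to order 1/(k+1) for each k, hence diverge, and by independence almost
   every x is hit infinitely often. *)

theory Submission
  imports Defs
begin

section \<open>Fourier tails of square-integrable functions\<close>

text \<open>Three requirements compete. The heights must tend to infinity, the squared heights times
  |E_k| must be O(2^-k) for the tail, and 2^k |E_k| must have a divergent sum so that almost every
  point is hit. Heights sqrt(k+1) with |E_k| about 2^-k / (k+1) meet all three because the harmonic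
  series diverges. The double exponential comes from the averages: an average over 2^(r+1) terms
  shifts the window up to 2^r times, and level k serves r up to about 2^(k+1), so M_k must reach
  2^(2^(k+1)). This also explains the rate: 2^k is both the number of stages that level k serves and
  the order of the double logarithm of its resolution. Since the double logarithm hardly notices a
  power of N, the Fourier estimates can be crude: Cauchy-Schwarz over all cells costs factors
  polynomial in the number of cells. The lower bound on f is what makes the first half of each
  average, about which nothing is known, cost only a constant.\<close>

interpretation torus: finite_measure torus_measure
  unfolding torus_measure_def
  by (rule finite_measure_lebesgue_on) (simp add: bounded_set_imp_lmeasurable)

lemma space_torus [simp]: "space torus_measure = {0..<1}"
  by (simp add: torus_measure_def)

lemma measure_space_torus [simp]: "measure torus_measure {0..<1} = 1"
  by (simp add: torus_measure_def measure_restrict_space)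

lemma borel_measurable_torus:
  "f \<in> borel_measurable borel \<Longrightarrow> f \<in> borel_measurable torus_measure"
  unfolding torus_measure_def
  by (intro measurable_restrict_space1 measurable_completion) (simp add: measurable_lborel1)

lemma integrable_torus_bounded:
  fixes F :: "real \<Rightarrow> 'a::{banach,second_countable_topology}"
  assumes "F \<in> borel_measurable torus_measure" "\<And>x. norm (F x) \<le> B"
  shows "integrable torus_measure F"
  using torus.integrable_const_bound[of F B] assms by auto

text \<open>The bridge to the fundamental theorem of calculus, which concerns gauge integrals on
  closed intervals; the extra endpoint 1 is negligible.\<close>

lemma integral_torus_eq:
  fixes F :: "real \<Rightarrow> 'a::euclidean_space"
  assumes "integrable torus_measure F" "(F has_integral I) {0..1}"
  shows "integral\<^sup>L torus_measure F = I"
proof -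
  have "(F has_integral integral\<^sup>L torus_measure F) {0..<1}"
    using assms(1) unfolding torus_measure_def by (intro has_integral_integral_lebesgue_on) auto
  moreover have "(F has_integral I) {0..<1}"
  proof -
    have "(F has_integral I) {0..<1} \<longleftrightarrow> (F has_integral I) {0..1}"
      by (rule has_integral_spike_set_eq; rule negligible_subset[of "{1::real}"]) auto
    then show ?thesis using assms(2) by blast
  qed
  ultimately show ?thesis by (rule has_integral_unique)
qed

section \<open>Characters and Bessel's identity\<close>

definition ch :: "int \<Rightarrow> real \<Rightarrow> complex" where
  "ch m x = exp (2 * of_real pi * \<i> * of_int m * of_real x)"

lemma fourier_coeff_ch: "fourier_coeff F m = (LINT x|torus_measure. F x * ch (- m) x)"
  by (simp add: fourier_coeff_def ch_def)

lemma fourier_partial_sum_ch: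
  "fourier_partial_sum N F x = (\<Sum>m\<in>{- int N..int N}. fourier_coeff F m * ch m x)"
proof -
  have "{m. \<bar>m\<bar> \<le> int N} = {- int N..int N}" by auto
  then show ?thesis by (simp add: fourier_partial_sum_def ch_def)
qed

lemma ch_mult: "ch m x * ch n x = ch (m + n) x"
  by (simp add: ch_def exp_add[symmetric] algebra_simps)

lemma ch_0 [simp]: "ch 0 x = 1" by (simp add: ch_def)

lemma norm_ch [simp]: "norm (ch m x) = 1"
  by (simp add: ch_def)

lemma cnj_ch: "cnj (ch m x) = ch (- m) x"
  by (simp add: ch_def exp_cnj)

lemma ch_Ints: "ch m (of_int k) = 1"
proof -
  have "2 * of_real pi * \<i> * of_int m * of_real (of_int k) = of_int (2 * (m * k)) * (of_real pi * \<i>)"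
    by simp
  then show ?thesis
    unfolding ch_def by (simp add: exp_eq_1 mult.assoc) (metis Ints_of_int of_int_mult of_int_numeral)
qed

lemma ch_at_1 [simp]: "ch m 1 = 1" and ch_at_0 [simp]: "ch m 0 = 1"
  using ch_Ints[of m 1] ch_Ints[of m 0] by auto

lemma ch_measurable [measurable]: "ch m \<in> borel_measurable borel"
  unfolding ch_def by measurable

lemma ch_has_vector_derivative:
  "(ch m has_vector_derivative 2 * of_real pi * \<i> * of_int m * ch m x) (at x within S)"
proof -
  have "((\<lambda>x. exp (2 * of_real pi * \<i> * of_int m * x)) has_field_derivative
      2 * of_real pi * \<i> * of_int m * exp (2 * of_real pi * \<i> * of_int m * x)) (at x)" for x :: complex
    by (auto intro!: derivative_eq_intros)
  from has_vector_derivative_real_field[OF this]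
  show ?thesis unfolding ch_def by (simp add: o_def)
qed

lemma integrable_ch: "integrable torus_measure (ch m)"
  by (rule integrable_torus_bounded[where B=1]) (auto intro: borel_measurable_torus)

lemma integral_ch: "integral\<^sup>L torus_measure (ch m) = (if m = 0 then 1 else 0)"
proof (cases "m = 0")
  case True
  have "ch 0 = (\<lambda>_. 1)" by auto
  then show ?thesis using True by simp
next
  case False
  let ?w = "2 * of_real pi * \<i> * of_int m :: complex"
  have "((\<lambda>x. ?w * ch m x / ?w) has_integral ch m 1 / ?w - ch m 0 / ?w) {0..1}"
    by (rule fundamental_theorem_of_calculus)
      (simp_all only: zero_le_one has_vector_derivative_divide[OF ch_has_vector_derivative])
  then have "(ch m has_integral 0) {0..1}" using False by simp
  from integral_torus_eq[OF integrable_ch this] show ?thesis using False by simp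
qed

definition sq_integrable :: "(real \<Rightarrow> complex) \<Rightarrow> bool" where
  "sq_integrable F \<longleftrightarrow> F \<in> borel_measurable torus_measure \<and> integrable torus_measure (\<lambda>x. (norm (F x))\<^sup>2)"

text \<open>The square of the \<open>L2_norm\<close> of the Fourier tail; without the root, Bessel's
  identity and the bounds for finite sums stay polynomial.\<close>

definition tail_energy :: "nat \<Rightarrow> (real \<Rightarrow> complex) \<Rightarrow> real" where
  "tail_energy N F = (LINT x|torus_measure. (norm (F x - fourier_partial_sum N F x))\<^sup>2)"

lemma integrable_dominated:
  fixes F :: "real \<Rightarrow> 'a::{banach,second_countable_topology}"
  assumes "integrable torus_measure g" "F \<in> borel_measurable torus_measure" "\<And>x. norm (F x) \<le> g x"
  shows "integrable torus_measure F"
  by (rule Bochner_Integration.integrable_bound[OF assms(1,2)]) (use assms(3) in \<open>auto intro: order_trans abs_ge_self\<close>)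

lemma sq_integrable_integrable:
  assumes "sq_integrable F" shows "integrable torus_measure F"
proof (rule integrable_dominated)
  show "integrable torus_measure (\<lambda>x. 1 + (norm (F x))\<^sup>2)"
    using assms by (auto simp: sq_integrable_def)
  show "F \<in> borel_measurable torus_measure" using assms by (auto simp: sq_integrable_def)
  fix x show "norm (F x) \<le> 1 + (norm (F x))\<^sup>2"
    using sum_squares_bound[of 1 "norm (F x)"] by (simp add: power2_eq_square) (smt (verit) norm_ge_zero)
qed

lemma sq_integrable_mult_ch:
  assumes "sq_integrable F" shows "integrable torus_measure (\<lambda>x. F x * ch m x)"
proof (rule integrable_dominated)
  show "integrable torus_measure (\<lambda>x. norm (F x))"
    using sq_integrable_integrable[OF assms] by auto
  show "(\<lambda>x. F x * ch m x) \<in> borel_measurable torus_measure"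
    using assms borel_measurable_torus[OF ch_measurable]
    by (auto simp: sq_integrable_def intro!: borel_measurable_times)
qed (simp add: norm_mult)

text \<open>Bessel's identity: in the expansion of |F - S|^2 the two cross terms and, by
  orthonormality of the characters, the square of S each contribute the same sum of |c_m|^2, with
  signs -, -, +. Integrability is recorded as well, since without it a Bochner integral has the
  default value 0.\<close>

lemma tail_energy_eq:
  assumes F: "sq_integrable F"
  shows "integrable torus_measure (\<lambda>x. (norm (F x - fourier_partial_sum N F x))\<^sup>2)"
    and "tail_energy N F = (LINT x|torus_measure. (norm (F x))\<^sup>2)
           - (\<Sum>m\<in>{- int N..int N}. (norm (fourier_coeff F m))\<^sup>2)"
proof -
  define c where "c = fourier_coeff F"
  let ?I = "{- int N..int N}"
  have pt: "complex_of_real ((norm (F x - fourier_partial_sum N F x))\<^sup>2) =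
     complex_of_real ((norm (F x))\<^sup>2) - (\<Sum>m\<in>?I. cnj (c m) * (F x * ch (- m) x))
      - (\<Sum>m\<in>?I. c m * cnj (F x * ch (- m) x)) + (\<Sum>m\<in>?I. \<Sum>k\<in>?I. c m * cnj (c k) * ch (m - k) x)" for x
  proof -
    let ?S = "\<Sum>m\<in>?I. c m * ch m x"
    have "complex_of_real ((norm (F x - ?S))\<^sup>2) = (F x - ?S) * cnj (F x - ?S)"
      by (simp add: complex_norm_square del: of_real_power)
    also have "\<dots> = F x * cnj (F x) - F x * cnj ?S - ?S * cnj (F x) + ?S * cnj ?S"
      by (simp add: algebra_simps)
    also have "F x * cnj ?S = (\<Sum>m\<in>?I. cnj (c m) * (F x * ch (- m) x))"
      by (simp add: sum_distrib_left cnj_ch algebra_simps)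
    also have "?S * cnj (F x) = (\<Sum>m\<in>?I. c m * cnj (F x * ch (- m) x))"
      by (simp add: sum_distrib_right sum_distrib_left cnj_ch algebra_simps)
    also have "?S * cnj ?S = (\<Sum>m\<in>?I. \<Sum>k\<in>?I. c m * cnj (c k) * (ch m x * ch (- k) x))"
      by (simp add: sum_product cnj_ch algebra_simps)
    finally show ?thesis
      by (simp add: fourier_partial_sum_ch c_def ch_mult complex_norm_square del: of_real_power)
  qed
  have i0: "integrable torus_measure (\<lambda>x. complex_of_real ((norm (F x))\<^sup>2))"
    using F by (auto simp: sq_integrable_def simp del: of_real_power)
  have i1: "integrable torus_measure (\<lambda>x. cnj (c m) * (F x * ch (- m) x))" for m
    using sq_integrable_mult_ch[OF F] by auto
  have i2: "integrable torus_measure (\<lambda>x. c m * cnj (F x * ch (- m) x))" for m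
    using sq_integrable_mult_ch[OF F, of "- m"] by (intro integrable_mult_right) (simp only: integrable_cnj)
  have i3: "integrable torus_measure (\<lambda>x. c m * cnj (c k) * ch (m - k) x)" for m k
    using integrable_ch by auto
  have int: "integrable torus_measure (\<lambda>x. complex_of_real ((norm (F x - fourier_partial_sum N F x))\<^sup>2))"
    unfolding pt using i0 i1 i2 i3 by (intro Bochner_Integration.integrable_add Bochner_Integration.integrable_diff Bochner_Integration.integrable_sum) auto
  then show "integrable torus_measure (\<lambda>x. (norm (F x - fourier_partial_sum N F x))\<^sup>2)"
    by (simp only: complex_of_real_integrable_eq)
  have "complex_of_real (tail_energy N F) =
      (LINT x|torus_measure. complex_of_real ((norm (F x - fourier_partial_sum N F x))\<^sup>2))"
    unfolding tail_energy_def by (rule integral_complex_of_real[symmetric])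
  also have "\<dots> = complex_of_real (LINT x|torus_measure. (norm (F x))\<^sup>2) - (\<Sum>m\<in>?I. cnj (c m) * c m)
       - (\<Sum>m\<in>?I. c m * cnj (c m)) + (\<Sum>m\<in>?I. \<Sum>k\<in>?I. c m * cnj (c k) * (if m = k then 1 else 0))"
  proof -
    have e1: "(LINT x|torus_measure. cnj (c m) * (F x * ch (- m) x)) = cnj (c m) * c m" for m
      by (simp add: c_def fourier_coeff_ch)
    have e2: "(LINT x|torus_measure. c m * cnj (F x * ch (- m) x)) = c m * cnj (c m)" for m
    proof -
      have "(LINT x|torus_measure. cnj (F x * ch (- m) x)) = cnj (c m)"
        unfolding c_def fourier_coeff_ch by (rule Bochner_Integration.integral_cnj)
      then show ?thesis by (simp only: integral_mult_right_zero)
    qed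
    have e3: "(LINT x|torus_measure. c m * cnj (c k) * ch (m - k) x) = c m * cnj (c k) * (if m = k then 1 else 0)" for m k
      by (simp add: integral_ch)
    have e0: "(LINT x|torus_measure. complex_of_real ((norm (F x))\<^sup>2)) = complex_of_real (LINT x|torus_measure. (norm (F x))\<^sup>2)"
      by (rule integral_complex_of_real)
    have "has_bochner_integral torus_measure
        (\<lambda>x. complex_of_real ((norm (F x - fourier_partial_sum N F x))\<^sup>2))
        (complex_of_real (LINT x|torus_measure. (norm (F x))\<^sup>2) - (\<Sum>m\<in>?I. cnj (c m) * c m)
          - (\<Sum>m\<in>?I. c m * cnj (c m)) + (\<Sum>m\<in>?I. \<Sum>k\<in>?I. c m * cnj (c k) * (if m = k then 1 else 0)))"
      unfolding pt
      by (intro has_bochner_integral_add has_bochner_integral_diff has_bochner_integral_sum)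
        (simp_all only: has_bochner_integral_iff i0 i1 i2 i3 e0 e1 e2 e3)
    then show ?thesis by (rule has_bochner_integral_integral_eq)
  qed
  also have "\<dots> = complex_of_real ((LINT x|torus_measure. (norm (F x))\<^sup>2) - (\<Sum>m\<in>?I. (norm (c m))\<^sup>2))"
  proof -
    have "(\<Sum>k\<in>?I. c m * cnj (c k) * (if m = k then 1 else 0)) = c m * cnj (c m)" if "m \<in> ?I" for m
    proof -
      have "(\<Sum>k\<in>?I. c m * cnj (c k) * (if m = k then 1 else 0)) = (\<Sum>k\<in>?I. if m = k then c m * cnj (c k) else 0)"
        by (rule sum.cong) auto
      also have "\<dots> = c m * cnj (c m)" using that by (subst sum.delta') auto
      finally show ?thesis .
    qed
    then have "(\<Sum>m\<in>?I. \<Sum>k\<in>?I. c m * cnj (c k) * (if m = k then 1 else 0)) = (\<Sum>m\<in>?I. c m * cnj (c m))"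
      by (rule sum.cong[OF refl])
    moreover have "c m * cnj (c m) = complex_of_real ((norm (c m))\<^sup>2)" "cnj (c m) * c m = complex_of_real ((norm (c m))\<^sup>2)" for m
      by (simp_all only: complex_norm_square mult.commute)
    ultimately show ?thesis by (simp only: of_real_diff of_real_sum) simp
  qed
  finally show "tail_energy N F = (LINT x|torus_measure. (norm (F x))\<^sup>2)
           - (\<Sum>m\<in>?I. (norm (fourier_coeff F m))\<^sup>2)"
    unfolding c_def by (simp only: of_real_eq_iff)
qed

lemma tail_energy_le: "sq_integrable F \<Longrightarrow> tail_energy N F \<le> (LINT x|torus_measure. (norm (F x))\<^sup>2)"
  by (simp add: tail_energy_eq sum_nonneg)

lemma sq_integrable_cmult: "sq_integrable F \<Longrightarrow> sq_integrable (\<lambda>x. c * F x)"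
  by (auto simp: sq_integrable_def norm_mult power_mult_distrib)

lemma sq_integrable_sum:
  assumes "finite I" "\<And>i. i \<in> I \<Longrightarrow> sq_integrable (F i)"
  shows "sq_integrable (\<lambda>x. \<Sum>i\<in>I. F i x)"
  unfolding sq_integrable_def
proof
  show m: "(\<lambda>x. \<Sum>i\<in>I. F i x) \<in> borel_measurable torus_measure"
    using assms by (intro borel_measurable_sum) (auto simp: sq_integrable_def)
  show "integrable torus_measure (\<lambda>x. (norm (\<Sum>i\<in>I. F i x))\<^sup>2)"
  proof (rule integrable_dominated)
    show "integrable torus_measure (\<lambda>x. real (card I) * (\<Sum>i\<in>I. (norm (F i x))\<^sup>2))"
      using assms by (auto simp: sq_integrable_def)
    show "(\<lambda>x. (norm (\<Sum>i\<in>I. F i x))\<^sup>2) \<in> borel_measurable torus_measure" using m by measurable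
    fix x
    have "(norm (\<Sum>i\<in>I. F i x))\<^sup>2 \<le> (\<Sum>i\<in>I. norm (F i x))\<^sup>2"
      by (simp add: norm_sum power_mono)
    also have "\<dots> \<le> real (card I) * (\<Sum>i\<in>I. (norm (F i x))\<^sup>2)"
      using sum_squared_le_sum_of_squares[of "\<lambda>i. norm (F i x)" I] by (simp add: mult.commute)
    finally show "norm ((norm (\<Sum>i\<in>I. F i x))\<^sup>2) \<le> real (card I) * (\<Sum>i\<in>I. (norm (F i x))\<^sup>2)" by simp
  qed
qed

lemma fourier_partial_sum_sum:
  assumes "finite I" "\<And>i. i \<in> I \<Longrightarrow> sq_integrable (F i)"
  shows "fourier_partial_sum N (\<lambda>x. \<Sum>i\<in>I. F i x) x = (\<Sum>i\<in>I. fourier_partial_sum N (F i) x)"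
proof -
  have "fourier_coeff (\<lambda>x. \<Sum>i\<in>I. F i x) m = (\<Sum>i\<in>I. fourier_coeff (F i) m)" for m
    unfolding fourier_coeff_ch sum_distrib_right
    by (rule Bochner_Integration.integral_sum) (use assms sq_integrable_mult_ch in auto)
  then show ?thesis
    unfolding fourier_partial_sum_ch by (simp add: sum_distrib_right) (rule sum.swap)
qed

lemma tail_energy_cmult: "tail_energy N (\<lambda>x. c * F x) = (norm c)\<^sup>2 * tail_energy N F"
proof -
  have "fourier_partial_sum N (\<lambda>x. c * F x) x = c * fourier_partial_sum N F x" for x
    unfolding fourier_partial_sum_ch fourier_coeff_ch by (simp add: sum_distrib_left mult.assoc)
  then show ?thesis
    unfolding tail_energy_def by (simp add: right_diff_distrib[symmetric] norm_mult power_mult_distrib del: right_diff_distrib)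
qed

text \<open>Pointwise Cauchy-Schwarz. The loss is polynomial in the number of summands, which the
  double logarithm in the final rate forgives.\<close>

lemma tail_energy_sum:
  assumes "finite I" "\<And>i. i \<in> I \<Longrightarrow> sq_integrable (F i)"
  shows "tail_energy N (\<lambda>x. \<Sum>i\<in>I. F i x) \<le> real (card I) * (\<Sum>i\<in>I. tail_energy N (F i))"
proof -
  let ?d = "\<lambda>i x. F i x - fourier_partial_sum N (F i) x"
  have "tail_energy N (\<lambda>x. \<Sum>i\<in>I. F i x) = (LINT x|torus_measure. (norm (\<Sum>i\<in>I. ?d i x))\<^sup>2)"
    unfolding tail_energy_def using assms by (simp add: fourier_partial_sum_sum sum_subtractf)
  also have "\<dots> \<le> (LINT x|torus_measure. real (card I) * (\<Sum>i\<in>I. (norm (?d i x))\<^sup>2))"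
  proof (rule integral_mono')
    show "integrable torus_measure (\<lambda>x. real (card I) * (\<Sum>i\<in>I. (norm (?d i x))\<^sup>2))"
      using assms tail_energy_eq(1) by auto
    fix x
    have "(norm (\<Sum>i\<in>I. ?d i x))\<^sup>2 \<le> (\<Sum>i\<in>I. norm (?d i x))\<^sup>2"
      by (simp add: norm_sum power_mono)
    also have "\<dots> \<le> real (card I) * (\<Sum>i\<in>I. (norm (?d i x))\<^sup>2)"
      using sum_squared_le_sum_of_squares[of "\<lambda>i. norm (?d i x)" I] by (simp add: mult.commute)
    finally show "(norm (\<Sum>i\<in>I. ?d i x))\<^sup>2 \<le> real (card I) * (\<Sum>i\<in>I. (norm (?d i x))\<^sup>2)" .
  qed (simp add: sum_nonneg)
  also have "\<dots> = real (card I) * (\<Sum>i\<in>I. tail_energy N (F i))"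
    unfolding tail_energy_def using assms tail_energy_eq(1)
    by (simp add: Bochner_Integration.integral_sum)
  finally show ?thesis .
qed

text \<open>For decompositions that hold only on [0,1), such as those into sawtooths, or only off a
  null set, such as the splitting of \<open>spikes\<close>.\<close>

lemma tail_energy_cong_AE:
  assumes "F \<in> borel_measurable torus_measure" "G \<in> borel_measurable torus_measure"
    and "AE x in torus_measure. F x = G x"
  shows "tail_energy N F = tail_energy N G"
proof -
  note [measurable] = assms(1,2) borel_measurable_torus[OF ch_measurable]
  have "fourier_coeff F m = fourier_coeff G m" for m
    unfolding fourier_coeff_ch
    by (rule integral_cong_AE) (use assms(3) in auto)
  then have "fourier_partial_sum N F x = fourier_partial_sum N G x" for x
    by (simp add: fourier_partial_sum_ch)
  then show ?thesis
    unfolding tail_energy_def fourier_partial_sum_ch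
    by (intro integral_cong_AE) (use assms(3) in auto)
qed

section \<open>Sawtooth functions and interval indicators\<close>

text \<open>On either side of its jump at \<open>a\<close>, \<open>frac (x - a)\<close> is a
  translation of x. The second argument of \<phi> lets one lemma serve the mean, the square and the
  product with a character.\<close>

lemma frac_has_integral:
  fixes \<phi> :: "real \<Rightarrow> real \<Rightarrow> 'a::euclidean_space"
  assumes a: "0 \<le> a" "a \<le> 1"
    and "((\<lambda>x. \<phi> (x + (1 - a)) x) has_integral I) {0..a}"
    and "((\<lambda>x. \<phi> (x + (- a)) x) has_integral J) {a..1}"
  shows "((\<lambda>x. \<phi> (frac (x - a)) x) has_integral I + J) {0..1}"
proof (rule has_integral_combine[OF a])
  show "((\<lambda>x. \<phi> (frac (x - a)) x) has_integral I) {0..a}"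
  proof (rule has_integral_spike[OF _ _ assms(3)])
    show "negligible {a}" by simp
    fix x assume "x \<in> {0..a} - {a}"
    then have "frac (x - a) = x - a + 1" using a by (intro frac_unique_iff[THEN iffD2]) auto
    then have "frac (x - a) = x + (1 - a)" by linarith
    then show "\<phi> (frac (x - a)) x = \<phi> (x + (1 - a)) x" by simp
  qed
  show "((\<lambda>x. \<phi> (frac (x - a)) x) has_integral J) {a..1}"
  proof (rule has_integral_spike[OF _ _ assms(4)])
    show "negligible {1::real}" by simp
    fix x assume "x \<in> {a..1} - {1}"
    then have "frac (x - a) = x - a" using a by (intro frac_unique_iff[THEN iffD2]) auto
    then show "\<phi> (frac (x - a)) x = \<phi> (x + (- a)) x" by simp
  qed
qed

lemma frac_measurable [measurable]: "(\<lambda>x. frac (x - a)) \<in> borel_measurable (borel :: real measure)"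
  unfolding frac_def by measurable

lemma sq_integrable_bounded:
  assumes "F \<in> borel_measurable torus_measure" "\<And>x. norm (F x) \<le> B"
  shows "sq_integrable F"
  unfolding sq_integrable_def
  using assms by (auto intro!: integrable_torus_bounded[where B="B\<^sup>2"] power_mono borel_measurable_power borel_measurable_norm)

lemma sq_integrable_sawtooth: "sq_integrable (\<lambda>x. complex_of_real (frac (x - a)))"
proof (rule sq_integrable_bounded)
  show "(\<lambda>x. complex_of_real (frac (x - a))) \<in> borel_measurable torus_measure"
    by (rule borel_measurable_torus) measurable
  show "norm (complex_of_real (frac (x - a))) \<le> 1" for x
    using frac_ge_0[of "x - a"] frac_lt_1[of "x - a"] by simp
qed

lemma integral_sawtooth_square:
  assumes a: "0 \<le> a" "a \<le> 1"
  shows "(LINT x|torus_measure. (frac (x - a))\<^sup>2) = 1 / 3"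
proof (rule integral_torus_eq)
  show "integrable torus_measure (\<lambda>x. (frac (x - a))\<^sup>2)"
    using sq_integrable_sawtooth[of a] by (simp add: sq_integrable_def)
  have piece: "((\<lambda>x. (x + b)\<^sup>2) has_integral (v + b) ^ 3 / 3 - (u + b) ^ 3 / 3) {u..v}" if "u \<le> v" for u v b :: real
    by (rule fundamental_theorem_of_calculus[OF that])
      (auto intro!: derivative_eq_intros simp: has_real_derivative_iff_has_vector_derivative[symmetric])
  have "((\<lambda>x. (frac (x - a))\<^sup>2) has_integral
     ((a + (1 - a)) ^ 3 / 3 - (0 + (1 - a)) ^ 3 / 3) + ((1 + (- a)) ^ 3 / 3 - (a + (- a)) ^ 3 / 3)) {0..1}"
    by (rule frac_has_integral[where \<phi>="\<lambda>y x. y\<^sup>2", OF a]) (rule piece, rule a)+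
  then show "((\<lambda>x. (frac (x - a))\<^sup>2) has_integral 1 / 3) {0..1}" by simp
qed

text \<open>For a linear function with one unit jump, integration by parts leaves only the jump, so
  the modulus of the coefficient does not depend on \<open>a\<close>.\<close>

lemma fourier_coeff_sawtooth:
  assumes a: "0 \<le> a" "a \<le> 1"
  shows "norm (fourier_coeff (\<lambda>x. complex_of_real (frac (x - a))) m) = (if m = 0 then 1 / 2 else 1 / (2 * pi * \<bar>real_of_int m\<bar>))"
proof (cases "m = 0")
  case True
  have piece: "((\<lambda>x. complex_of_real (x + b)) has_integral complex_of_real ((v + b) ^ 2 / 2 - (u + b) ^ 2 / 2)) {u..v}" if "u \<le> v" for u v b :: real
    by (rule has_integral_of_real, rule fundamental_theorem_of_calculus[OF that])
      (auto intro!: derivative_eq_intros simp: has_real_derivative_iff_has_vector_derivative[symmetric])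
  have "((\<lambda>x. complex_of_real (frac (x - a))) has_integral
     complex_of_real ((a + (1 - a)) ^ 2 / 2 - (0 + (1 - a)) ^ 2 / 2) + complex_of_real ((1 + (- a)) ^ 2 / 2 - (a + (- a)) ^ 2 / 2)) {0..1}"
    by (rule frac_has_integral[where \<phi>="\<lambda>y x. complex_of_real y", OF a]) (rule piece, rule a)+
  then have "((\<lambda>x. complex_of_real (frac (x - a))) has_integral 1 / 2) {0..1}" by simp
  from integral_torus_eq[OF sq_integrable_integrable[OF sq_integrable_sawtooth] this]
  have "fourier_coeff (\<lambda>x. complex_of_real (frac (x - a))) m = 1 / 2"
    using True by (simp add: fourier_coeff_ch del: integral_complex_of_real)
  then show ?thesis using True by (simp only: norm_divide if_True) simp
next
  case False
  define n where "n = - m"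
  define l where "l = 2 * of_real pi * \<i> * of_int n"
  have l: "l \<noteq> 0" using False by (simp add: l_def n_def)
  \<comment> \<open>An antiderivative of \<open>of_real (x + b) * ch n x\<close>, found by
    parts.\<close>
  define P where "P = (\<lambda>b x. ((of_real x + of_real b) / l - 1 / l\<^sup>2) * ch n x)"
  have "(P b has_vector_derivative of_real (x + b) * ch n x) (at x within S)" for b x S
  proof -
    have d: "((\<lambda>x. (of_real x + of_real b) / l - 1 / l\<^sup>2) has_vector_derivative 1 / l) (at x within S)"
      by (auto intro!: derivative_eq_intros has_vector_derivative_of_real)
    have "((of_real x + of_real b) / l - 1 / l\<^sup>2) * (l * ch n x) + 1 / l * ch n x = of_real (x + b) * ch n x"
      using l by (simp add: field_simps power2_eq_square)
    then show ?thesis unfolding P_def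
      using has_vector_derivative_mult[OF d ch_has_vector_derivative[of n x S]]
      unfolding l_def[symmetric] by (simp only:)
  qed
  then have piece: "((\<lambda>x. complex_of_real (x + b) * ch n x) has_integral P b v - P b u) {u..v}" if "u \<le> v" for u v b :: real
    by (intro fundamental_theorem_of_calculus[OF that])
  have "((\<lambda>x. complex_of_real (frac (x - a)) * ch n x) has_integral
     (P (1 - a) a - P (1 - a) 0) + (P (- a) 1 - P (- a) a)) {0..1}"
    by (rule frac_has_integral[where \<phi>="\<lambda>y x. complex_of_real y * ch n x", OF a]) (rule piece, rule a)+
  \<comment> \<open>The values at 0 and 1 cancel by periodicity; the unit jump at \<open>a\<close>
    remains.\<close>
  moreover have "(P (1 - a) a - P (1 - a) 0) + (P (- a) 1 - P (- a) a) = ch n a / l"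
    using l by (simp add: P_def field_simps)
  ultimately have "((\<lambda>x. complex_of_real (frac (x - a)) * ch n x) has_integral ch n a / l) {0..1}" by simp
  from integral_torus_eq[OF sq_integrable_mult_ch[OF sq_integrable_sawtooth] this]
  show ?thesis using False by (simp add: fourier_coeff_ch n_def[symmetric] norm_divide) (simp add: l_def n_def norm_mult)
qed

text \<open>By the Basel sum the left side is the sum of 1/n^2 over n > N, which is compared with
  the telescoping 1/(n-1) - 1/n.\<close>

lemma zeta_2_tail:
  assumes "N > 0"
  shows "pi\<^sup>2 / 6 - (\<Sum>m = 1..N. 1 / (real m)\<^sup>2) \<le> 1 / real N"
proof -
  let ?f = "\<lambda>n. 1 / (real (n + 1))\<^sup>2"
  have s: "?f sums (pi\<^sup>2 / 6)" using inverse_squares_sums by (simp add: add.commute)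
  have s1: "(\<lambda>n. ?f (n + N)) sums (pi\<^sup>2 / 6 - (\<Sum>n<N. ?f n))"
    by (rule sums_split_initial_segment[OF s])
  have s2: "(\<lambda>n. - (1 / real (Suc n + N)) - - (1 / real (n + N))) sums (0 - - (1 / real (0 + N)))"
  proof (rule telescope_sums)
    show "(\<lambda>n. - (1 / real (n + N))) \<longlonglongrightarrow> 0"
      using tendsto_minus[OF LIMSEQ_ignore_initial_segment[OF lim_1_over_n[where 'a=real], of N]] by simp
  qed
  have le: "?f (n + N) \<le> - (1 / real (Suc n + N)) - - (1 / real (n + N))" for n
  proof -
    have "1 / (y + 1)\<^sup>2 \<le> - (1 / (y + 1)) - - (1 / y)" if "y > 0" for y :: real
    proof -
      have "- (1 / (y + 1)) - - (1 / y) = 1 / (y * (y + 1))" using that by (simp add: divide_simps)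
      moreover have "y * (y + 1) \<le> (y + 1)\<^sup>2" using that by (simp add: power2_eq_square)
      ultimately show ?thesis using that by (simp add: frac_le)
    qed
    moreover have "real (n + N + 1) = real (n + N) + 1" "real (Suc n + N) = real (n + N) + 1" "real (n + N) > 0"
      using assms by simp_all
    ultimately show ?thesis by metis
  qed
  have "pi\<^sup>2 / 6 - (\<Sum>n<N. ?f n) \<le> 0 - - (1 / real (0 + N))"
    by (rule sums_le[OF le s1 s2])
  moreover have "(\<Sum>n<N. ?f n) = (\<Sum>m = 1..N. 1 / (real m)\<^sup>2)"
    by (rule sum.reindex_bij_witness[of _ "\<lambda>m. m - 1" Suc]) auto
  ultimately show ?thesis by simp
qed

text \<open>Bessel's identity gives 1/3 - 1/4 - z/(2 pi^2), where z is the partial sum of 1/m^2. As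
  1/12 equals (pi^2/6)/(2 pi^2), what remains is the remainder of the Basel series.\<close>

lemma tail_energy_sawtooth:
  assumes a: "0 \<le> a" "a \<le> 1" and N: "N > 0"
  shows "tail_energy N (\<lambda>x. complex_of_real (frac (x - a))) \<le> 1 / (2 * pi\<^sup>2 * real N)"
proof -
  let ?c = "\<lambda>m. (norm (fourier_coeff (\<lambda>x. complex_of_real (frac (x - a))) m))\<^sup>2"
  let ?z = "\<Sum>m = 1..N. 1 / (real m)\<^sup>2"
  have pos: "(\<Sum>m\<in>{1..int N}. ?c m) = ?z / (4 * pi\<^sup>2)"
  proof -
    have "(\<Sum>m\<in>{1..int N}. ?c m) = (\<Sum>m=1..N. ?c (int m))"
      by (rule sum.reindex_bij_witness[of _ int nat]) auto
    also have "\<dots> = (\<Sum>m=1..N. 1 / (real m)\<^sup>2 / (4 * pi\<^sup>2))"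
      by (rule sum.cong) (auto simp: fourier_coeff_sawtooth[OF a] power2_eq_square)
    finally show ?thesis by (simp add: sum_divide_distrib)
  qed
  have neg: "(\<Sum>m\<in>{- int N.. - 1}. ?c m) = (\<Sum>m\<in>{1..int N}. ?c m)"
    by (rule sum.reindex_bij_witness[of _ uminus uminus]) (auto simp: fourier_coeff_sawtooth[OF a])
  have "{- int N..int N} = {- int N.. - 1} \<union> ({0} \<union> {1..int N})" by auto
  then have "(\<Sum>m\<in>{- int N..int N}. ?c m) = (\<Sum>m\<in>{- int N.. - 1}. ?c m) + (?c 0 + (\<Sum>m\<in>{1..int N}. ?c m))"
    by (simp only:, subst sum.union_disjoint, simp, simp, fastforce, subst sum.union_disjoint) auto
  also have "\<dots> = 1 / 4 + ?z / (2 * pi\<^sup>2)"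
    unfolding neg pos by (simp add: fourier_coeff_sawtooth[OF a] power2_eq_square)
  finally have "tail_energy N (\<lambda>x. complex_of_real (frac (x - a))) = 1 / 3 - (1 / 4 + ?z / (2 * pi\<^sup>2))"
    using integral_sawtooth_square[OF a] by (simp add: tail_energy_eq(2)[OF sq_integrable_sawtooth])
  also have "\<dots> = (pi\<^sup>2 / 6 - ?z) / (2 * pi\<^sup>2)" by (simp add: diff_divide_distrib)
  also have "\<dots> \<le> (1 / real N) / (2 * pi\<^sup>2)"
    by (rule divide_right_mono[OF zeta_2_tail[OF N]]) simp
  finally show ?thesis by (simp add: mult.commute)
qed

lemma tail_energy_const: "tail_energy N (\<lambda>x. c) = 0"
proof -
  have "fourier_coeff (\<lambda>x. c) m = (if m = 0 then c else 0)" for m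
    by (simp add: fourier_coeff_ch integral_ch)
  then have "fourier_partial_sum N (\<lambda>x. c) x = c" for x
    by (simp add: fourier_partial_sum_ch if_distrib[of "\<lambda>z. z * _"] cong: if_cong)
  then show ?thesis by (simp add: tail_energy_def)
qed

lemma sq_integrable_const: "sq_integrable (\<lambda>x. c)"
  by (rule sq_integrable_bounded[where B="norm c"]) auto

text \<open>The slopes of the two sawtooths cancel, and their jumps at \<open>a\<close> and
  \<open>b\<close> switch the indicator on and off.\<close>

lemma indicator_eq_sawtooth:
  fixes a b x :: real
  assumes "0 \<le> a" "a \<le> b" "b \<le> 1" "0 \<le> x" "x < 1"
  shows "indicator {a..<b} x = (b - a) - frac (x - a) + frac (x - b)"
proof -
  have fr: "frac (x - c) = (if c \<le> x then x - c else x - c + 1)" if "0 \<le> c" "c \<le> 1" for c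
    using that assms by (auto simp: frac_unique_iff)
  show ?thesis using assms fr[of a] fr[of b] by (auto simp: indicator_def)
qed

lemma sq_integrable_indicator:
  "S \<in> sets borel \<Longrightarrow> sq_integrable (\<lambda>x. complex_of_real (indicator S x))"
  by (rule sq_integrable_bounded[where B=1]) (auto intro!: borel_measurable_torus simp: indicator_def)

text \<open>Of the three summands in \<open>indicator_eq_sawtooth\<close> the constant has no tail,
  so Cauchy-Schwarz gives 3 * 2e = 3/(pi^2 N).\<close>

lemma tail_energy_interval:
  assumes ab: "0 \<le> a" "a \<le> b" "b \<le> 1" and N: "N > 0"
  shows "tail_energy N (\<lambda>x. complex_of_real (indicator {a..<b} x)) \<le> 1 / real N"
proof -
  define e where "e = 1 / (2 * pi\<^sup>2 * real N)"
  define F where "F = (\<lambda>i::nat. if i = 0 then (\<lambda>x. complex_of_real (b - a))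
     else if i = 1 then (\<lambda>x. - 1 * complex_of_real (frac (x - a))) else (\<lambda>x. complex_of_real (frac (x - b))))"
  have sq: "sq_integrable (F i)" for i
    unfolding F_def using sq_integrable_const sq_integrable_cmult[OF sq_integrable_sawtooth, of "-1"] sq_integrable_sawtooth by simp
  have I3: "{..<3} = {0, 1, 2::nat}" by auto
  have "tail_energy N (\<lambda>x. complex_of_real (indicator {a..<b} x)) = tail_energy N (\<lambda>x. \<Sum>i<3. F i x)"
  proof (rule tail_energy_cong_AE)
    show "(\<lambda>x. complex_of_real (indicator {a..<b} x)) \<in> borel_measurable torus_measure"
      using sq_integrable_indicator[of "{a..<b}"] by (simp add: sq_integrable_def)
    show "(\<lambda>x. \<Sum>i<3. F i x) \<in> borel_measurable torus_measure"
      using sq by (intro borel_measurable_sum) (auto simp: sq_integrable_def)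
    show "AE x in torus_measure. complex_of_real (indicator {a..<b} x) = (\<Sum>i<3. F i x)"
      by (rule AE_I2) (simp add: indicator_eq_sawtooth ab F_def I3)
  qed
  also have "\<dots> \<le> real (card {..<3::nat}) * (\<Sum>i<3. tail_energy N (F i))"
    by (rule tail_energy_sum) (auto simp: sq)
  also have "\<dots> \<le> 3 * (0 + e + e)"
  proof -
    have "(\<Sum>i<3. tail_energy N (F i)) = tail_energy N (F 0) + tail_energy N (F 1) + tail_energy N (F 2)"
      by (simp add: I3)
    moreover have "tail_energy N (F 0) = 0" by (simp add: F_def tail_energy_const)
    moreover have "tail_energy N (F 1) \<le> e"
      using tail_energy_sawtooth[of a N] ab N tail_energy_cmult[of N "-1" "\<lambda>x. complex_of_real (frac (x - a))"]
      by (simp add: F_def e_def)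
    moreover have "tail_energy N (F 2) \<le> e"
      using tail_energy_sawtooth[of b N] ab N by (simp add: F_def e_def)
    moreover have "3 * s \<le> 3 * (0 + e + e)" if "s = x + y + z" "x = 0" "y \<le> e" "z \<le> e" for s x y z :: real
      using that by simp
    ultimately show ?thesis unfolding card_lessThan of_nat_numeral by blast
  qed
  also have "\<dots> = 3 / pi\<^sup>2 * (1 / real N)" by (simp add: e_def field_simps)
  also have "\<dots> \<le> 1 * (1 / real N)"
  proof (rule mult_right_mono)
    have "3 \<le> pi * pi" using pi_gt3 mult_mono[of 1 pi 3 pi] by simp
    then show "3 / pi\<^sup>2 \<le> 1" by (simp add: power2_eq_square)
  qed simp
  finally show ?thesis by simp
qed

section \<open>Dyadic sets and blocks of zero digits\<close>

text \<open>The binary digits of x in places s + 1 to s + q after the point are all 0. The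
  \<open>mod\<close> discards the earlier digits and the integer part, which makes the set
  1-periodic.\<close>

definition zero_block :: "nat \<Rightarrow> nat \<Rightarrow> real set" where
  "zero_block s q = {x. \<lfloor>2 ^ (s + q) * x\<rfloor> mod 2 ^ q = 0}"

text \<open>A union of half-open intervals of length 2^-t with endpoints in 2^-t Z: membership is
  decided by the integer part and the first t binary digits.\<close>

definition dyadic :: "nat \<Rightarrow> real set \<Rightarrow> bool" where
  "dyadic t U \<longleftrightarrow> (\<forall>x y. \<lfloor>2 ^ t * x\<rfloor> = \<lfloor>2 ^ t * y\<rfloor> \<longrightarrow> x \<in> U \<longrightarrow> y \<in> U)"

lemma floor_power2_div: "\<lfloor>2 ^ t * x\<rfloor> = \<lfloor>2 ^ (t + d) * x :: real\<rfloor> div 2 ^ d"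
proof -
  have "\<lfloor>2 ^ (t + d) * x / real_of_int (2 ^ d)\<rfloor> = \<lfloor>2 ^ (t + d) * x\<rfloor> div 2 ^ d"
    by (rule floor_divide_real_eq_div) simp
  then show ?thesis by (simp add: power_add)
qed

lemma dyadic_mono:
  assumes "dyadic t U" "t \<le> u" shows "dyadic u U"
proof -
  obtain d where u: "u = t + d" using assms(2) le_Suc_ex by blast
  show ?thesis unfolding dyadic_def
  proof (intro allI impI)
    fix x y :: real
    assume "\<lfloor>2 ^ u * x\<rfloor> = \<lfloor>2 ^ u * y\<rfloor>" "x \<in> U"
    moreover from this(1) have "\<lfloor>2 ^ t * x\<rfloor> = \<lfloor>2 ^ t * y\<rfloor>"
      by (simp only: floor_power2_div[of t _ d] u)
    ultimately show "y \<in> U" using assms(1) unfolding dyadic_def by blast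
  qed
qed

lemma dyadic_zero_block:
  assumes "s + q \<le> t" shows "dyadic t (zero_block s q)"
proof (rule dyadic_mono[OF _ assms])
  show "dyadic (s + q) (zero_block s q)"
    unfolding dyadic_def zero_block_def mem_Collect_eq by (intro allI impI) (simp only:)
qed

lemma dyadic_UNIV: "dyadic t UNIV"
  by (simp add: dyadic_def)

lemma dyadicD: "dyadic t U \<Longrightarrow> \<lfloor>2 ^ t * x\<rfloor> = \<lfloor>2 ^ t * y\<rfloor> \<Longrightarrow> x \<in> U \<longleftrightarrow> y \<in> U"
  unfolding dyadic_def by metis

lemma dyadicI: "(\<And>x y. \<lfloor>2 ^ t * x\<rfloor> = \<lfloor>2 ^ t * y\<rfloor> \<Longrightarrow> x \<in> U \<Longrightarrow> y \<in> U) \<Longrightarrow> dyadic t U"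
  unfolding dyadic_def by (intro allI impI)

lemma dyadic_Diff:
  assumes "dyadic t U" "dyadic t V" shows "dyadic t (U - V)"
  by (rule dyadicI) (use assms[THEN dyadicD] in blast)

lemma dyadic_UN: "(\<And>i. i \<in> I \<Longrightarrow> dyadic t (U i)) \<Longrightarrow> dyadic t (\<Union>i\<in>I. U i)"
  unfolding dyadic_def by blast

lemma dyadic_borel:
  assumes "dyadic t U" shows "U \<in> sets borel"
proof -
  have "U = {x \<in> space borel. \<lfloor>2 ^ t * x\<rfloor> \<in> (\<lambda>x. \<lfloor>2 ^ t * x\<rfloor>) ` U}"
  proof
    show "{x \<in> space borel. \<lfloor>2 ^ t * x\<rfloor> \<in> (\<lambda>x. \<lfloor>2 ^ t * x\<rfloor>) ` U} \<subseteq> U"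
    proof
      fix x :: real assume "x \<in> {x \<in> space borel. \<lfloor>2 ^ t * x\<rfloor> \<in> (\<lambda>x. \<lfloor>2 ^ t * x\<rfloor>) ` U}"
      then obtain y where "\<lfloor>2 ^ t * y\<rfloor> = \<lfloor>2 ^ t * x\<rfloor>" "y \<in> U" by force
      then show "x \<in> U" using assms unfolding dyadic_def by blast
    qed
  qed auto
  also have "\<dots> \<in> sets borel" by measurable
  finally show ?thesis .
qed

lemma zero_block_borel [measurable]: "zero_block s q \<in> sets borel"
  by (rule dyadic_borel[OF dyadic_zero_block[OF order_refl]])

text \<open>Multiplication by a power of 2 shifts the digits, which is why the n_j are powers of
  2.\<close>

lemma power2_mult_in_zero_block: "2 ^ l * x \<in> zero_block s q \<longleftrightarrow> x \<in> zero_block (s + l) q"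
  by (simp add: zero_block_def power_add algebra_simps)

lemma zero_block_periodic: "x + 1 \<in> zero_block s q \<longleftrightarrow> x \<in> zero_block s q"
proof -
  have "2 ^ (s + q) * (x + 1) = 2 ^ (s + q) * x + real_of_int (2 ^ s * 2 ^ q)"
    by (simp add: algebra_simps power_add)
  then have "\<lfloor>2 ^ (s + q) * (x + 1)\<rfloor> = \<lfloor>2 ^ (s + q) * x\<rfloor> + 2 ^ s * 2 ^ q"
    by (metis floor_add_int)
  then show ?thesis by (simp add: zero_block_def)
qed

section \<open>Measure of dyadic sets and independence of binary digits\<close>

definition mu :: "real set \<Rightarrow> real" where
  "mu U = measure torus_measure (U \<inter> {0..<1})"

lemma sets_torus: "U \<in> sets borel \<Longrightarrow> U \<inter> {0..<1} \<in> sets torus_measure"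
  unfolding torus_measure_def sets_restrict_space
  by (rule image_eqI[of _ _ U]) (auto simp: Int_commute)

lemma mu_UNIV [simp]: "mu UNIV = 1"
  by (simp add: mu_def)

lemma measure_torus_interval:
  assumes "0 \<le> a" "a \<le> b" "b \<le> 1"
  shows "measure torus_measure {a..<b} = b - a"
proof -
  have "{a..<b} \<subseteq> {0..<1}" using assms by auto
  then show ?thesis using assms by (simp add: torus_measure_def measure_restrict_space)
qed

definition cell :: "nat \<Rightarrow> nat \<Rightarrow> real set" where
  "cell t c = {real c / 2 ^ t..<real (Suc c) / 2 ^ t}"

lemma in_cell_iff: "x \<in> cell t c \<longleftrightarrow> \<lfloor>2 ^ t * x\<rfloor> = int c"
  by (simp add: cell_def floor_eq_iff field_simps)

lemma cell_subset: "c < 2 ^ t \<Longrightarrow> cell t c \<subseteq> {0..<1}"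
proof -
  assume "c < 2 ^ t"
  then have "real (Suc c) \<le> real (2 ^ t)" by (simp only: of_nat_le_iff)
  then have "real (Suc c) / 2 ^ t \<le> 1" by (simp add: divide_simps)
  then show ?thesis by (auto simp: cell_def)
qed

lemma Union_cells: "(\<Union>c<2 ^ t. cell t c) = {0..<1}"
proof
  show "(\<Union>c<2 ^ t. cell t c) \<subseteq> {0..<1}" using cell_subset by blast
  show "{0..<1} \<subseteq> (\<Union>c<2 ^ t. cell t c)"
  proof
    fix x :: real assume x: "x \<in> {0..<1}"
    have "0 \<le> \<lfloor>2 ^ t * x\<rfloor>" "\<lfloor>2 ^ t * x\<rfloor> < 2 ^ t" using x by (auto simp: floor_less_iff)
    then have "x \<in> cell t (nat \<lfloor>2 ^ t * x\<rfloor>)" "nat \<lfloor>2 ^ t * x\<rfloor> < 2 ^ t"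
      by (auto simp: in_cell_iff nat_less_iff)
    then show "x \<in> (\<Union>c<2 ^ t. cell t c)" by blast
  qed
qed

lemma cell_borel: "cell t c \<in> sets borel"
  by (simp add: cell_def)

lemma mu_eq_sum_cells:
  assumes "V \<in> sets borel"
  shows "mu V = (\<Sum>c<2 ^ t. measure torus_measure (V \<inter> cell t c))"
proof -
  have "V \<inter> {0..<1} = (\<Union>c<2 ^ t. V \<inter> cell t c)"
    unfolding Union_cells[of t, symmetric] by blast
  moreover have "measure torus_measure (\<Union>c<2 ^ t. V \<inter> cell t c) = (\<Sum>c<2 ^ t. measure torus_measure (V \<inter> cell t c))"
  proof (rule torus.finite_measure_finite_Union)
    show "(\<lambda>c. V \<inter> cell t c) ` {..<2 ^ t} \<subseteq> sets torus_measure"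
    proof (rule image_subsetI)
      fix c :: nat assume "c \<in> {..<2 ^ t}"
      then have "(V \<inter> cell t c) \<inter> {0..<1} = V \<inter> cell t c" using cell_subset[of c t] by blast
      then show "V \<inter> cell t c \<in> sets torus_measure"
        using sets_torus[OF sets.Int[OF assms cell_borel[of t c]]] by (simp only:)
    qed
    show "disjoint_family_on (\<lambda>c. V \<inter> cell t c) {..<2 ^ t}"
      unfolding disjoint_family_on_def
    proof (intro ballI impI)
      fix c d :: nat assume "c \<noteq> d"
      then have "cell t c \<inter> cell t d = {}" by (auto simp: in_cell_iff)
      then show "(V \<inter> cell t c) \<inter> (V \<inter> cell t d) = {}" by blast
    qed
  qed simp
  ultimately show ?thesis unfolding mu_def by simp
qed

lemma dyadic_Int_cell:
  assumes "dyadic t U" shows "U \<inter> cell t c = (if real c / 2 ^ t \<in> U then cell t c else {})"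
proof -
  have "x \<in> U \<longleftrightarrow> real c / 2 ^ t \<in> U" if "x \<in> cell t c" for x
    using that by (intro dyadicD[OF assms]) (simp add: in_cell_iff)
  then show ?thesis by auto
qed

lemma zero_block_Int_cell:
  "zero_block s q \<inter> cell s c = {real c / 2 ^ s..<real c / 2 ^ s + 1 / 2 ^ (s + q)}"
proof -
  have "x \<in> zero_block s q \<inter> cell s c \<longleftrightarrow> \<lfloor>2 ^ (s + q) * x\<rfloor> = int c * 2 ^ q" for x :: real
  proof -
    have "z mod 2 ^ q = 0 \<and> z div 2 ^ q = int c \<longleftrightarrow> z = int c * 2 ^ q" for z :: int
      using div_mult_mod_eq[of z "2 ^ q"] by auto
    then show ?thesis unfolding Int_iff in_cell_iff floor_power2_div[of s x q] by (simp add: zero_block_def)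
  qed
  then show ?thesis
    by (auto simp: set_eq_iff floor_eq_iff field_simps power_add)
qed

text \<open>Independence: \<open>U\<close> reads the first s digits, the block reads the next q. In
  every cell of length 2^-s contained in \<open>U\<close>, the block keeps the leftmost fraction
  2^-q.\<close>

lemma mu_Int_zero_block:
  assumes U: "dyadic s U"
  shows "mu (U \<inter> zero_block s q) = mu U / 2 ^ q"
proof -
  note Ub = dyadic_borel[OF U]
  have "measure torus_measure ((U \<inter> zero_block s q) \<inter> cell s c) = measure torus_measure (U \<inter> cell s c) / 2 ^ q"
    if c: "c < 2 ^ s" for c
  proof -
    have "(U \<inter> zero_block s q) \<inter> cell s c = (if real c / 2 ^ s \<in> U then zero_block s q \<inter> cell s c else {})"
      using dyadic_Int_cell[OF U, of c] by (auto split: if_splits)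
    moreover have "measure torus_measure (zero_block s q \<inter> cell s c) = measure torus_measure (cell s c) / 2 ^ q"
    proof -
      have "real (Suc c) \<le> real (2 ^ s)" using c by (simp only: of_nat_le_iff)
      then have b: "real (Suc c) / 2 ^ s \<le> 1" by (simp add: divide_simps)
      have "1 / (2::real) ^ (s + q) \<le> 1 / 2 ^ s" by (rule frac_le) auto
      then have "real c / 2 ^ s + 1 / 2 ^ (s + q) \<le> real (Suc c) / 2 ^ s" by (simp add: add_divide_distrib)
      then have "real c / 2 ^ s + 1 / 2 ^ (s + q) \<le> 1" using b by linarith
      then have "measure torus_measure (zero_block s q \<inter> cell s c) = 1 / 2 ^ (s + q)"
        unfolding zero_block_Int_cell by (subst measure_torus_interval) auto
      moreover have "measure torus_measure (cell s c) = 1 / 2 ^ s"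
        unfolding cell_def using b by (subst measure_torus_interval) (auto simp: divide_right_mono add_divide_distrib)
      ultimately show ?thesis by (simp add: power_add)
    qed
    ultimately show ?thesis unfolding dyadic_Int_cell[OF U] by simp
  qed
  then show ?thesis
    using Ub mu_eq_sum_cells[of "U \<inter> zero_block s q" s] mu_eq_sum_cells[of U s]
    by (simp add: sum_divide_distrib)
qed

lemma mu_zero_block: "mu (zero_block s q) = 1 / 2 ^ q"
  using mu_Int_zero_block[OF dyadic_UNIV, of s q] by simp

lemma mu_Diff_zero_block:
  assumes U: "dyadic s U"
  shows "mu (U - zero_block s q) = (1 - 1 / 2 ^ q) * mu U"
proof -
  note Ub = dyadic_borel[OF U]
  have "(U - zero_block s q) \<inter> {0..<1} = U \<inter> {0..<1} - (U \<inter> zero_block s q) \<inter> {0..<1}" by auto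
  then have "mu (U - zero_block s q) = mu U - mu (U \<inter> zero_block s q)"
    unfolding mu_def using Ub
    by (simp only:) (rule torus.finite_measure_Diff, auto intro!: sets_torus)
  then show ?thesis using mu_Int_zero_block[OF U] by (simp add: algebra_simps)
qed

text \<open>Each further block is independent of the digits read so far, so avoiding it multiplies
  the measure by \<open>1 - 1 / 2 ^ q\<close>. Dyadicity is carried along as the independence
  hypothesis for the next step.\<close>

lemma mu_Diff_zero_blocks:
  assumes U: "dyadic s U"
  shows "dyadic (s + q * m) (U - (\<Union>i<m. zero_block (s + q * i) q))
     \<and> mu (U - (\<Union>i<m. zero_block (s + q * i) q)) = (1 - 1 / 2 ^ q) ^ m * mu U"
proof (induction m)
  case 0
  then show ?case using U by simp
next
  case (Suc m)
  have eq: "U - (\<Union>i<Suc m. zero_block (s + q * i) q) =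
      (U - (\<Union>i<m. zero_block (s + q * i) q)) - zero_block (s + q * m) q"
    by (auto simp: lessThan_Suc)
  show ?case
    unfolding eq using Suc
    by (auto simp: mu_Diff_zero_block intro!: dyadic_Diff dyadic_zero_block elim!: dyadic_mono)
qed

lemma mu_mono: "U \<subseteq> V \<Longrightarrow> V \<in> sets borel \<Longrightarrow> mu U \<le> mu V"
  unfolding mu_def by (intro torus.finite_measure_mono sets_torus) auto

text \<open>At most 2^t cells are involved, each an interval of energy at most 1/N; Cauchy-Schwarz
  squares their number.\<close>

lemma tail_energy_dyadic:
  assumes U: "dyadic t U" and N: "N > 0"
  shows "tail_energy N (\<lambda>x. complex_of_real (indicator U x)) \<le> 4 ^ t / real N"
proof -
  define C where "C = {c. c < 2 ^ t \<and> real c / 2 ^ t \<in> U}"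
  have C: "finite C" "card C \<le> 2 ^ t"
    using card_mono[of "{..<2 ^ t}" C] by (auto simp: C_def)
  have pt: "complex_of_real (indicator U x) = (\<Sum>c\<in>C. complex_of_real (indicator (cell t c) x))" if x: "x \<in> {0..<1}" for x
  proof -
    obtain c where c: "c < 2 ^ t" "x \<in> cell t c" using x Union_cells[of t] by blast
    have "indicator (cell t d) x = (if d = c then 1 else (0::real))" for d
      using c by (auto simp: in_cell_iff indicator_def)
    moreover have "x \<in> U \<longleftrightarrow> c \<in> C" using dyadic_Int_cell[OF U, of c] c by (auto simp: C_def split: if_splits)
    ultimately show ?thesis using C
      by (simp add: indicator_def[of U] if_distrib[of complex_of_real] cong: if_cong)
  qed
  have "tail_energy N (\<lambda>x. complex_of_real (indicator U x)) = tail_energy N (\<lambda>x. \<Sum>c\<in>C. complex_of_real (indicator (cell t c) x))"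
  proof (rule tail_energy_cong_AE)
    show "(\<lambda>x. complex_of_real (indicator U x)) \<in> borel_measurable torus_measure"
      using sq_integrable_indicator[OF dyadic_borel[OF U]] by (simp add: sq_integrable_def)
    show "(\<lambda>x. \<Sum>c\<in>C. complex_of_real (indicator (cell t c) x)) \<in> borel_measurable torus_measure"
      using sq_integrable_indicator[OF cell_borel] by (intro borel_measurable_sum) (simp add: sq_integrable_def)
    show "AE x in torus_measure. complex_of_real (indicator U x) = (\<Sum>c\<in>C. complex_of_real (indicator (cell t c) x))"
      by (rule AE_I2) (simp add: pt)
  qed
  also have "\<dots> \<le> real (card C) * (\<Sum>c\<in>C. tail_energy N (\<lambda>x. complex_of_real (indicator (cell t c) x)))"
    by (rule tail_energy_sum[OF C(1)]) (rule sq_integrable_indicator[OF cell_borel])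
  also have "\<dots> \<le> real (card C) * (\<Sum>c\<in>C. 1 / real N)"
  proof (intro mult_left_mono sum_mono)
    fix c assume "c \<in> C"
    then have "real (Suc c) \<le> real (2 ^ t)" by (simp only: of_nat_le_iff C_def) auto
    then have "real (Suc c) / 2 ^ t \<le> 1" by (simp add: divide_simps)
    then show "tail_energy N (\<lambda>x. complex_of_real (indicator (cell t c) x)) \<le> 1 / real N"
      unfolding cell_def using N by (intro tail_energy_interval) (auto simp: divide_right_mono)
  qed simp
  also have "\<dots> = real (card C) * real (card C) / real N" by simp
  also have "\<dots> \<le> (2 ^ t * 2 ^ t) / real N"
  proof -
    have "real (card C) \<le> 2 ^ t" using C(2) by (metis of_nat_le_iff of_nat_numeral of_nat_power)
    then show ?thesis by (intro divide_right_mono mult_mono) auto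
  qed
  also have "\<dots> = 4 ^ t / real N" by (simp add: power_mult_distrib[symmetric])
  finally show ?thesis .
qed

text \<open>The second Borel-Cantelli lemma. By \<open>sep\<close> the stages read disjoint digits,
  so the chance of avoiding a run of stages is a product of powers
  \<open>(1 - 1 / 2 ^ q) ^ m\<close>, hence at most exp of minus a partial sum of the divergent
  series.\<close>

lemma AE_infinitely_many_zero_blocks:
  fixes \<sigma> q m :: "nat \<Rightarrow> nat"
  assumes sep: "\<And>r. \<sigma> r + q r * m r \<le> \<sigma> (Suc r)"
    and div: "\<not> summable (\<lambda>r. real (m r) / 2 ^ q r)"
  shows "AE x in torus_measure. \<exists>\<^sub>\<infinity>r. x \<in> (\<Union>i<m r. zero_block (\<sigma> r + q r * i) (q r))"
proof -
  define V where "V r = (\<Union>i<m r. zero_block (\<sigma> r + q r * i) (q r))" for r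
  have Vb: "V r \<in> sets borel" for r unfolding V_def by auto
  define p where "p r = real (m r) / 2 ^ q r" for r
  have p0: "p r \<ge> 0" for r by (simp add: p_def)
  have step: "dyadic (\<sigma> (a + n)) (UNIV - (\<Union>r\<in>{a..<a + n}. V r)) \<and>
      mu (UNIV - (\<Union>r\<in>{a..<a + n}. V r)) \<le> exp (- (\<Sum>r\<in>{a..<a + n}. p r))" for a n
  proof (induction n)
    case 0
    then show ?case by (simp add: dyadic_UNIV)
  next
    case (Suc n)
    define W where "W = UNIV - (\<Union>r\<in>{a..<a + n}. V r)"
    let ?r = "a + n"
    have eq: "UNIV - (\<Union>r\<in>{a..<a + Suc n}. V r) = W - V ?r"
      by (auto simp: W_def atLeastLessThanSuc)
    have W: "dyadic (\<sigma> ?r) W" "mu W \<le> exp (- (\<Sum>r\<in>{a..<a + n}. p r))" using Suc by (auto simp: W_def)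
    have d: "dyadic (\<sigma> ?r + q ?r * m ?r) (W - V ?r)" and v: "mu (W - V ?r) = (1 - 1 / 2 ^ q ?r) ^ m ?r * mu W"
      using mu_Diff_zero_blocks[OF W(1)] by (auto simp: V_def)
    have "(1 - 1 / (2::real) ^ q ?r) ^ m ?r \<le> exp (- p ?r)"
    proof -
      have "1 + - (1 / (2::real) ^ q ?r) \<le> exp (- (1 / 2 ^ q ?r))" by (rule exp_ge_add_one_self)
      then have "(1 - 1 / (2::real) ^ q ?r) ^ m ?r \<le> exp (- (1 / 2 ^ q ?r)) ^ m ?r"
        by (intro power_mono) auto
      then show ?thesis by (simp add: exp_of_nat_mult[symmetric] p_def)
    qed
    then have "mu (W - V ?r) \<le> exp (- p ?r) * exp (- (\<Sum>r\<in>{a..<a + n}. p r))"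
      unfolding v using W(2) by (intro mult_mono) (auto simp: mu_def)
    then show ?case unfolding eq using dyadic_mono[OF d] sep[of ?r]
      by (simp add: exp_add[symmetric] algebra_simps)
  qed
  have null: "AE x in torus_measure. \<exists>r\<ge>a. x \<in> V r" for a
  proof -
    define Z where "Z = UNIV - (\<Union>r\<in>{a..}. V r)"
    have Zb: "Z \<in> sets borel" unfolding Z_def using Vb by auto
    have "mu Z \<le> e" if "e > 0" for e
    proof -
      have "\<not> summable (\<lambda>n. p (n + a))" using div by (simp add: p_def[abs_def] summable_iff_shift[of "\<lambda>r. real (m r) / 2 ^ q r" a])
      \<comment> \<open>A partial sum above \<open>- ln e\<close> pushes the exponential bound below
        \<open>e\<close>.\<close>
      have "\<exists>n. \<not> (\<Sum>i<n. p (i + a)) \<le> - ln e"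
      proof (rule ccontr)
        assume "\<nexists>n. \<not> (\<Sum>i<n. p (i + a)) \<le> - ln e"
        then have "(\<Sum>i<Suc n. p (i + a)) \<le> - ln e" for n by blast
        then have "(\<Sum>i\<le>n. p (i + a)) \<le> - ln e" for n by (simp only: lessThan_Suc_atMost)
        then have "summable (\<lambda>n. p (n + a))" by (rule bounded_imp_summable[OF p0])
        with \<open>\<not> summable (\<lambda>n. p (n + a))\<close> show False by blast
      qed
      then obtain n where n: "(\<Sum>i<n. p (i + a)) > - ln e"
        unfolding not_le by blast
      have "(\<Sum>i<n. p (i + a)) = (\<Sum>r\<in>{a..<a + n}. p r)"
        by (rule sum.reindex_bij_witness[of _ "\<lambda>r. r - a" "\<lambda>i. i + a"]) auto
      then have "exp (- (\<Sum>r\<in>{a..<a + n}. p r)) \<le> e"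
        using n that by (subst ln_ge_iff[symmetric]) auto
      moreover have "mu Z \<le> mu (UNIV - (\<Union>r\<in>{a..<a + n}. V r))"
        by (rule mu_mono[OF _ dyadic_borel[OF conjunct1[OF step[of a n]]]]) (auto simp: Z_def)
      ultimately show ?thesis using step[of a n] by linarith
    qed
    then have "mu Z \<le> 0 + e" if "e > 0" for e using that by (simp only: add_0)
    then have "mu Z \<le> 0" by (rule field_le_epsilon)
    then have "mu Z = 0" using measure_nonneg[of torus_measure "Z \<inter> {0..<1}"] unfolding mu_def by linarith
    then have "Z \<inter> {0..<1} \<in> null_sets torus_measure"
      unfolding mu_def using sets_torus[OF Zb] by (simp add: null_sets_def torus.emeasure_eq_measure)
    then have "AE x in torus_measure. x \<notin> Z \<inter> {0..<1}" by (rule AE_not_in)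
    then show ?thesis
    proof (rule AE_mp, intro AE_I2 impI)
      fix x assume "x \<in> space torus_measure" "x \<notin> Z \<inter> {0..<1}"
      then show "\<exists>r\<ge>a. x \<in> V r" unfolding Z_def by auto
    qed
  qed
  have "AE x in torus_measure. \<forall>a. \<exists>r\<ge>a. x \<in> V r" using null by (simp add: AE_all_countable)
  then show ?thesis by (simp add: V_def INFM_nat_le)
qed

section \<open>The spike function\<close>

text \<open>This is M_k of the overview; \<open>width k\<close> is q_k and \<open>rare k\<close> is
  E_k.\<close>

definition blocks :: "nat \<Rightarrow> nat" where
  "blocks k = 2 ^ 2 ^ (k + 1)"

text \<open>In the union bound the three summands in turn cancel \<open>blocks k\<close>, give the
  factor 2^-k, and give 1/(k+1) up to a factor 2.\<close>

definition width :: "nat \<Rightarrow> nat" where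
  "width k = 2 ^ (k + 1) + k + floor_log (k + 1)"

definition depth :: "nat \<Rightarrow> nat" where
  "depth k = width k * blocks k"

definition rare :: "nat \<Rightarrow> real set" where
  "rare k = (\<Union>i<blocks k. zero_block (width k * i) (width k))"

definition height :: "nat \<Rightarrow> real" where
  "height k = sqrt (real (k + 1))"

lemma dyadic_rare: "dyadic (depth k) (rare k)"
  unfolding rare_def
proof (rule dyadic_UN, rule dyadic_zero_block)
  fix i assume "i \<in> {..<blocks k}"
  then have "width k * Suc i \<le> width k * blocks k" by (intro mult_le_mono2) simp
  then show "width k * i + width k \<le> depth k" by (simp add: depth_def)
qed

lemma rare_borel [measurable]: "rare k \<in> sets borel"
  by (rule dyadic_borel[OF dyadic_rare])

lemma rare_periodic: "x + 1 \<in> rare k \<longleftrightarrow> x \<in> rare k"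
  by (simp add: rare_def zero_block_periodic)

lemma height_ge_1: "height k \<ge> 1" by (simp add: height_def)

lemma height_mono: "k \<le> l \<Longrightarrow> height k \<le> height l" by (simp add: height_def)

lemma height_le: "height k \<le> real (k + 1)"
  unfolding height_def by (rule real_le_lsqrt) (auto simp: power2_eq_square)

lemma height_sq: "(height k)\<^sup>2 = real (k + 1)" by (simp add: height_def)

lemma blocks_div_width: "real (blocks k) / 2 ^ width k = 1 / (2 ^ k * 2 ^ floor_log (k + 1))"
  by (simp add: blocks_def width_def power_add)

text \<open>Dilation by 2^m moves all blocks by m digits, which the union bound does not notice. The
  dilated form is meant for the points n_j x.\<close>

lemma mu_rare_dilate:
  "{x. 2 ^ m * x \<in> rare k} \<in> sets borel"
  "mu {x. 2 ^ m * x \<in> rare k} \<le> 1 / (2 ^ k * 2 ^ floor_log (k + 1))"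
proof -
  have eq: "{x. 2 ^ m * x \<in> rare k} = (\<Union>i<blocks k. zero_block (width k * i + m) (width k))"
    by (auto simp: rare_def power2_mult_in_zero_block)
  show "{x. 2 ^ m * x \<in> rare k} \<in> sets borel" unfolding eq by auto
  have "mu {x. 2 ^ m * x \<in> rare k} \<le> (\<Sum>i<blocks k. mu (zero_block (width k * i + m) (width k)))"
    unfolding eq mu_def Int_UN_distrib2 UN_extend_simps
    by (rule torus.finite_measure_subadditive_finite) (auto intro!: sets_torus)
  also have "\<dots> = real (blocks k) / 2 ^ width k" by (simp add: mu_zero_block)
  finally show "mu {x. 2 ^ m * x \<in> rare k} \<le> 1 / (2 ^ k * 2 ^ floor_log (k + 1))"
    by (simp add: blocks_div_width)
qed

text \<open>Rounding the logarithm down costs at most a factor 2, the 2 in the last bound. That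
  bound is the balance of heights and measures behind the tail rate.\<close>

lemma mu_rare:
  "mu (rare k) \<le> 1 / (2 ^ k * 2 ^ floor_log (k + 1))" "mu (rare k) \<le> 1 / 2 ^ k"
  "(height k)\<^sup>2 * mu (rare k) \<le> 2 / 2 ^ k"
proof -
  show 1: "mu (rare k) \<le> 1 / (2 ^ k * 2 ^ floor_log (k + 1))" using mu_rare_dilate(2)[of 0 k] by simp
  also have "\<dots> \<le> 1 / 2 ^ k" by (simp add: divide_simps)
  finally show "mu (rare k) \<le> 1 / 2 ^ k" .
  have "real (k + 1) \<le> real (2 * 2 ^ floor_log (k + 1))"
    by (simp only: of_nat_le_iff floor_log_exp2_ge)
  then have a: "real (k + 1) \<le> 2 * 2 ^ floor_log (k + 1)" by simp
  have "(height k)\<^sup>2 * mu (rare k) \<le> (2 * 2 ^ floor_log (k + 1)) * (1 / (2 ^ k * 2 ^ floor_log (k + 1)))"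
    unfolding height_sq by (rule mult_mono[OF a 1]) (auto simp: mu_def)
  then show "(height k)\<^sup>2 * mu (rare k) \<le> 2 / 2 ^ k" by simp
qed

text \<open>The first Borel-Cantelli lemma. It concerns 2^m x because f is evaluated at all the
  points n_j x, where infinitely many spikes would give \<open>spikes\<close> its default value
  0.\<close>

lemma AE_finite_rare: "AE x in torus_measure. finite {k. 2 ^ m * x \<in> rare k}"
proof -
  let ?A = "\<lambda>k. {x. 2 ^ m * x \<in> rare k} \<inter> {0..<1}"
  have "AE x in torus_measure. eventually (\<lambda>k. x \<in> space torus_measure - ?A k) sequentially"
  proof (rule borel_cantelli_AE1)
    show "?A k \<in> sets torus_measure" for k by (rule sets_torus[OF mu_rare_dilate(1)])
    show "emeasure torus_measure (?A k) < \<infinity>" for k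
      by (simp add: less_top[symmetric])
    show "summable (\<lambda>k. measure torus_measure (?A k))"
    proof (rule summable_comparison_test'[OF summable_geometric[of "1 / 2"], of 0])
      fix k
      have "mu {x. 2 ^ m * x \<in> rare k} \<le> 1 / (2 ^ k * 2 ^ floor_log (k + 1))" by (rule mu_rare_dilate)
      also have "\<dots> \<le> 1 / 2 ^ k" by (simp add: divide_simps)
      finally show "norm (measure torus_measure (?A k)) \<le> (1 / 2) ^ k"
        by (simp add: mu_def power_divide)
    qed simp
  qed
  then show ?thesis
  proof (rule AE_mp, intro AE_I2 impI)
    fix x assume x: "x \<in> space torus_measure" and "eventually (\<lambda>k. x \<in> space torus_measure - ?A k) sequentially"
    then obtain K where K: "\<And>k. k \<ge> K \<Longrightarrow> x \<notin> ?A k" by (auto simp: eventually_sequentially)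
    have "{k. 2 ^ m * x \<in> rare k} \<subseteq> {..<K}"     proof
      fix k assume "k \<in> {k. 2 ^ m * x \<in> rare k}"
      then have "x \<in> ?A k" using x by simp
      then show "k \<in> {..<K}" using K[of k] by (cases "k \<ge> K") auto
    qed
    then show "finite {k. 2 ^ m * x \<in> rare k}" by (rule finite_subset) simp
  qed
qed

text \<open>A sum over an infinite index set is \<open>0\<close>, so \<open>spikes K\<close> vanishes on the null set where
  infinitely many of the \<open>rare k\<close> occur.\<close>

definition spikes :: "nat \<Rightarrow> real \<Rightarrow> real" where
  "spikes K x = (\<Sum>j | x \<in> rare (K + j). height (K + j))"

lemma spikes_nonneg: "spikes K x \<ge> 0"
  unfolding spikes_def by (rule sum_nonneg) (simp add: height_def)

lemma spikes_periodic: "spikes K (x + 1) = spikes K x"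
  by (simp add: spikes_def rare_periodic)

lemma suminf_indicator_infinite:
  fixes a :: "nat \<Rightarrow> real"
  assumes "infinite {j. x \<in> F j}" "\<And>j. a j \<ge> 1"
  shows "(\<Sum>j. ennreal (a j * indicator (F j) x)) = \<infinity>"
proof (rule ccontr)
  assume "(\<Sum>j. ennreal (a j * indicator (F j) x)) \<noteq> \<infinity>"
  then obtain t where t: "(\<Sum>j. ennreal (a j * indicator (F j) x)) = ennreal t" "t \<ge> 0"
    by (cases "\<Sum>j. ennreal (a j * indicator (F j) x)") auto
  obtain B where B: "B \<subseteq> {j. x \<in> F j}" "finite B" "card B = nat \<lceil>t\<rceil> + 1"
    using infinite_arbitrarily_large[OF assms(1)] by blast
  have "ennreal (real (card B)) = ennreal (\<Sum>j\<in>B. 1)" by simp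
  also have "\<dots> \<le> ennreal (\<Sum>j\<in>B. a j * indicator (F j) x)"
    using B(1) assms(2) by (intro ennreal_leI sum_mono) (auto simp: indicator_def)
  also have "\<dots> = (\<Sum>j\<in>B. ennreal (a j * indicator (F j) x))"
    using assms(2) by (intro sum_ennreal[symmetric]) (auto simp: indicator_def intro: order_trans[OF zero_le_one])
  also have "\<dots> \<le> ennreal t" unfolding t(1)[symmetric] by (rule sum_le_suminf[OF summableI B(2)]) simp
  finally have "real (card B) \<le> t" using t(2) by (simp add: ennreal_le_iff)
  then show False using B(3) t(2) by linarith
qed

text \<open>Where infinitely many spikes occur, both sides take the default value 0: the sum over an
  infinite set, and \<open>enn2real\<close> of infinity. The right side makes Borel measurability
  evident.\<close>

lemma spikes_eq: "spikes K x = enn2real (\<Sum>j. ennreal (height (K + j) * indicator (rare (K + j)) x))"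
proof (cases "finite {j. x \<in> rare (K + j)}")
  case True
  have "(\<Sum>j. ennreal (height (K + j) * indicator (rare (K + j)) x))
      = (\<Sum>j\<in>{j. x \<in> rare (K + j)}. ennreal (height (K + j) * indicator (rare (K + j)) x))"
    by (rule suminf_finite[OF True]) simp
  also have "\<dots> = (\<Sum>j\<in>{j. x \<in> rare (K + j)}. ennreal (height (K + j)))"
    by (rule sum.cong) auto
  also have "\<dots> = ennreal (spikes K x)"
    unfolding spikes_def by (rule sum_ennreal) (simp add: height_def)
  finally show ?thesis by (simp add: spikes_nonneg)
next
  case False
  then show ?thesis
    using suminf_indicator_infinite[of x "\<lambda>j. rare (K + j)" "\<lambda>j. height (K + j)"] height_ge_1
    by (simp add: spikes_def)
qed

lemma spikes_measurable [measurable]: "spikes K \<in> borel_measurable borel"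
  unfolding spikes_eq[abs_def] by measurable

text \<open>If m is the largest index that occurs, there are at most m + 1 spikes and none is higher
  than \<open>height (K + m)\<close>, so the term j = m alone dominates. Indices are counted from K,
  so that the factor j + 1 does not grow with K.\<close>

lemma spikes_powr_le:
  assumes p: "p > 0"
  shows "ennreal (spikes K x powr p)
    \<le> (\<Sum>j. ennreal ((real (j + 1) * height (K + j)) powr p * indicator (rare (K + j)) x))"
proof (cases "finite {j. x \<in> rare (K + j)} \<and> {j. x \<in> rare (K + j)} \<noteq> {}")
  case True
  define S where "S = {j. x \<in> rare (K + j)}"
  have S: "finite S" "S \<noteq> {}" using True by (auto simp: S_def)
  define m where "m = Max S"
  have m: "m \<in> S" "\<And>j. j \<in> S \<Longrightarrow> j \<le> m" using S by (auto simp: m_def)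
  have "card S \<le> card {..m}" using m(2) by (intro card_mono) auto
  then have "real (card S) \<le> real (m + 1)" by simp
  have "spikes K x \<le> real (card S) * height (K + m)"
    unfolding spikes_def S_def[symmetric] using m(2) by (intro sum_bounded_above height_mono) simp
  also have "\<dots> \<le> real (m + 1) * height (K + m)"
    by (rule mult_right_mono[OF \<open>real (card S) \<le> real (m + 1)\<close>]) (simp add: height_def)
  finally have "spikes K x powr p \<le> (real (m + 1) * height (K + m)) powr p"
    using p spikes_nonneg by (intro powr_mono2) auto
  then have "ennreal (spikes K x powr p) \<le> (\<Sum>j\<in>{m}. ennreal ((real (j + 1) * height (K + j)) powr p * indicator (rare (K + j)) x))"
    using m(1) by (simp add: S_def ennreal_leI)
  also have "\<dots> \<le> (\<Sum>j. ennreal ((real (j + 1) * height (K + j)) powr p * indicator (rare (K + j)) x))"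
    by (rule sum_le_suminf) auto
  finally show ?thesis .
next
  case False
  \<comment> \<open>Default value: a sum over an infinite set is 0, like the sum over the empty
    set.\<close>
  then have "spikes K x = 0" unfolding spikes_def by (metis (mono_tags, lifting) sum.empty sum.infinite)
  then show ?thesis using p by simp
qed

lemma integral_spikes_powr:
  assumes p: "p > 0" and summ: "summable (\<lambda>j. (real (j + 1) * height (K + j)) powr p * mu (rare (K + j)))"
  shows "integrable torus_measure (\<lambda>x. spikes K x powr p)"
    and "(LINT x|torus_measure. spikes K x powr p) \<le> (\<Sum>j. (real (j + 1) * height (K + j)) powr p * mu (rare (K + j)))"
proof -
  let ?b = "\<lambda>j. (real (j + 1) * height (K + j)) powr p"
  have meas: "(\<lambda>x. spikes K x powr p) \<in> borel_measurable torus_measure"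
    by (rule borel_measurable_torus) measurable
  have meas2: "(\<lambda>x. ennreal (?b j * indicator (rare (K + j)) x)) \<in> borel_measurable torus_measure" for j
    by (rule borel_measurable_torus) measurable
  have ind: "(\<integral>\<^sup>+x. ennreal (?b j * indicator (rare (K + j)) x) \<partial>torus_measure) = ennreal (?b j * mu (rare (K + j)))" for j
  proof -
    have "(\<integral>\<^sup>+x. ennreal (?b j * indicator (rare (K + j)) x) \<partial>torus_measure)
        = (\<integral>\<^sup>+x. ennreal (?b j) * indicator (rare (K + j) \<inter> {0..<1}) x \<partial>torus_measure)"
      by (rule nn_integral_cong) (auto simp: indicator_def)
    also have "\<dots> = ennreal (?b j) * emeasure torus_measure (rare (K + j) \<inter> {0..<1})"
      by (rule nn_integral_cmult_indicator[OF sets_torus[OF rare_borel]])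
    also have "\<dots> = ennreal (?b j * mu (rare (K + j)))"
      by (simp add: mu_def torus.emeasure_eq_measure ennreal_mult)
    finally show ?thesis .
  qed
  have "(\<integral>\<^sup>+x. ennreal (spikes K x powr p) \<partial>torus_measure)
      \<le> (\<integral>\<^sup>+x. (\<Sum>j. ennreal (?b j * indicator (rare (K + j)) x)) \<partial>torus_measure)"
    by (rule nn_integral_mono) (rule spikes_powr_le[OF p])
  also have "\<dots> = (\<Sum>j. ennreal (?b j * mu (rare (K + j))))"
    by (subst nn_integral_suminf[OF meas2]) (simp only: ind)
  also have "\<dots> = ennreal (\<Sum>j. ?b j * mu (rare (K + j)))"
    by (rule suminf_ennreal2[OF _ summ]) (simp add: mu_def)
  finally have le: "(\<integral>\<^sup>+x. ennreal (spikes K x powr p) \<partial>torus_measure) \<le> ennreal (\<Sum>j. ?b j * mu (rare (K + j)))" .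
  show int: "integrable torus_measure (\<lambda>x. spikes K x powr p)"
    by (rule integrableI_nonneg[OF meas]) (use le in \<open>auto simp: le_less_trans[OF _ ennreal_less_top]\<close>)
  have "0 \<le> (\<Sum>j. ?b j * mu (rare (K + j)))" by (rule suminf_nonneg[OF summ]) (simp add: mu_def)
  then show "(LINT x|torus_measure. spikes K x powr p) \<le> (\<Sum>j. ?b j * mu (rare (K + j)))"
    using le nn_integral_eq_integral[OF int] by (simp add: ennreal_le_iff)
qed

lemma summable_power_times_geometric: "summable (\<lambda>j. real (j + 1) ^ n * (1 / 2) ^ j)"
proof -
  have "(\<lambda>j. (1 + 1 / real (Suc j)) ^ n) \<longlonglongrightarrow> (1 + 0) ^ n"
    by (intro tendsto_intros LIMSEQ_Suc lim_1_over_n)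
  then have "(\<lambda>j. (1 + 1 / real (Suc j)) ^ n) \<longlonglongrightarrow> 1" by simp
  then have "eventually (\<lambda>j. (1 + 1 / real (Suc j)) ^ n < 3 / 2) sequentially"
    by (rule order_tendstoD) simp
  then obtain J where J: "\<And>j. j \<ge> J \<Longrightarrow> (1 + 1 / real (Suc j)) ^ n < 3 / 2"
    by (auto simp: eventually_sequentially)
  show ?thesis
  proof (rule summable_ratio_test[of "3 / 4" J])
    fix j assume "j \<ge> J"
    have "real (Suc j + 1) = real (j + 1) * (1 + 1 / real (Suc j))" by (simp add: field_simps)
    then have "real (Suc j + 1) ^ n = real (j + 1) ^ n * (1 + 1 / real (Suc j)) ^ n"
      by (simp only: power_mult_distrib)
    also have "\<dots> \<le> real (j + 1) ^ n * (3 / 2)"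
      using J[OF \<open>j \<ge> J\<close>] by (intro mult_left_mono) auto
    finally have "real (Suc j + 1) ^ n * (1 / 2) ^ Suc j \<le> real (j + 1) ^ n * (3 / 2) * (1 / 2) ^ Suc j"
      by (rule mult_right_mono) simp
    then show "norm (real (Suc j + 1) ^ n * (1 / 2) ^ Suc j) \<le> 3 / 4 * norm (real (j + 1) ^ n * (1 / 2) ^ j)"
      by (simp add: abs_mult)
  qed simp
qed

lemma integrable_spikes_powr:
  assumes p: "p \<ge> 1"
  shows "integrable torus_measure (\<lambda>x. spikes 0 x powr p)"
proof (rule integral_spikes_powr(1))
  show "p > 0" using p by simp
  \<comment> \<open>As \<open>height j\<close> is at most \<open>j + 1\<close>, the base is at most
    (j + 1)^2, whose p-th power has exponent 2p.\<close>
  define n where "n = nat \<lceil>2 * p\<rceil>"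
  have "2 * p \<le> real n" by (simp add: n_def real_nat_ceiling_ge)
  have bd: "(real (j + 1) * height (0 + j)) powr p * mu (rare (0 + j)) \<le> real (j + 1) ^ n * (1 / 2) ^ j" for j
  proof (rule mult_mono)
    have "(real (j + 1) * height (0 + j)) powr p \<le> (real (j + 1) * real (j + 1)) powr p"
      using height_le[of j] p by (intro powr_mono2 mult_left_mono) (auto simp: height_def)
    also have "\<dots> = real (j + 1) powr (2 * p)"
      by (simp only: powr_mult powr_add[symmetric] mult_2)
    also have "\<dots> \<le> real (j + 1) powr real n"
      using \<open>2 * p \<le> real n\<close> by (intro powr_mono) auto
    also have "\<dots> = real (j + 1) ^ n" by (rule powr_realpow) simp
    finally show "(real (j + 1) * height (0 + j)) powr p \<le> real (j + 1) ^ n" .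
    show "mu (rare (0 + j)) \<le> (1 / 2) ^ j" using mu_rare(2)[of j] by (simp add: power_divide)
  qed (auto simp: mu_def)
  show "summable (\<lambda>j. (real (j + 1) * height (0 + j)) powr p * mu (rare (0 + j)))"
    by (rule summable_comparison_test'[OF summable_power_times_geometric[of n], of 0])
      (use bd in \<open>simp add: mu_def\<close>)
qed

lemma powr_2_eq_power2: "x \<ge> 0 \<Longrightarrow> x powr 2 = (x::real)\<^sup>2"
  by (cases "x = 0") (auto simp: powr_numeral)

text \<open>The factor 2 is that of the last bound in \<open>mu_rare\<close>; the weights are those
  of \<open>spikes_powr_le\<close> for p = 2.\<close>

definition spike_const :: real where
  "spike_const = 2 * (\<Sum>j. real (j + 1) ^ 2 * (1 / 2) ^ j)"

lemma spike_const_nonneg: "spike_const \<ge> 0"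
  unfolding spike_const_def by (intro mult_nonneg_nonneg suminf_nonneg summable_power_times_geometric) auto

text \<open>Squared height times measure is at most 2/2^(K+j), so 2^-K factors out and the remaining
  series in j does not depend on K.\<close>

lemma spikes_square:
  shows "integrable torus_measure (\<lambda>x. (spikes K x)\<^sup>2)"
    and "(LINT x|torus_measure. (spikes K x)\<^sup>2) \<le> spike_const / 2 ^ K"
proof -
  let ?b = "\<lambda>j. (real (j + 1) * height (K + j)) powr 2 * mu (rare (K + j))"
  let ?g = "\<lambda>j. 2 / 2 ^ K * (real (j + 1) ^ 2 * (1 / 2) ^ j)"
  have bd: "?b j \<le> ?g j" for j
  proof -
    have "?b j = real (j + 1) ^ 2 * ((height (K + j))\<^sup>2 * mu (rare (K + j)))"
      by (subst powr_2_eq_power2) (auto simp: height_def power_mult_distrib)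
    also have "\<dots> \<le> real (j + 1) ^ 2 * (2 / 2 ^ (K + j))"
      by (intro mult_left_mono mu_rare(3)) simp
    also have "\<dots> = ?g j" by (simp add: power_add power_divide)
    finally show ?thesis .
  qed
  have sg: "summable ?g" by (rule summable_mult[OF summable_power_times_geometric])
  have sb: "summable ?b"
    by (rule summable_comparison_test'[OF sg, of 0]) (use bd in \<open>simp add: mu_def\<close>)
  have eq: "(\<lambda>x. spikes K x powr 2) = (\<lambda>x. (spikes K x)\<^sup>2)"
    by (rule ext) (simp add: powr_2_eq_power2 spikes_nonneg)
  show "integrable torus_measure (\<lambda>x. (spikes K x)\<^sup>2)"
    using integral_spikes_powr(1)[OF _ sb] unfolding eq by simp
  have "(LINT x|torus_measure. (spikes K x)\<^sup>2) \<le> suminf ?b"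
    using integral_spikes_powr(2)[OF _ sb] unfolding eq by simp
  also have "\<dots> \<le> suminf ?g" by (rule suminf_le[OF bd sb sg])
  also have "\<dots> = 2 / 2 ^ K * (\<Sum>j. real (j + 1) ^ 2 * (1 / 2) ^ j)"
    by (rule suminf_mult[OF summable_power_times_geometric])
  also have "\<dots> = spike_const / 2 ^ K" by (simp add: spike_const_def)
  finally show "(LINT x|torus_measure. (spikes K x)\<^sup>2) \<le> spike_const / 2 ^ K" .
qed

lemma sq_integrable_spikes: "sq_integrable (\<lambda>x. complex_of_real (spikes K x))"
  using spikes_square(1)[of K] by (auto simp: sq_integrable_def intro!: borel_measurable_torus)

definition spike_mean :: real where
  "spike_mean = (LINT x|torus_measure. spikes 0 x)"

lemma spike_mean_nonneg: "spike_mean \<ge> 0"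
  unfolding spike_mean_def by (simp add: spikes_nonneg)

definition spiky :: "real \<Rightarrow> real" where
  "spiky x = spikes 0 x - spike_mean"

text \<open>Terms of an average about which nothing is known cost at most \<open>spike_mean\<close>
  each.\<close>

lemma spiky_ge: "spiky x \<ge> - spike_mean"
  using spikes_nonneg[of 0 x] by (simp add: spiky_def)

lemma integral_spiky: "(LINT x|torus_measure. spiky x) = 0"
proof -
  have "integrable torus_measure (\<lambda>x. spikes 0 x)"
    using sq_integrable_integrable[OF sq_integrable_spikes[of 0]] by (simp only: complex_of_real_integrable_eq)
  then show ?thesis by (simp add: spiky_def spike_mean_def)
qed

lemma spiky_in_Lp:
  assumes p: "p \<ge> 1" shows "in_Lp p spiky"
  unfolding in_Lp_def
proof (intro conjI)
  show "one_periodic spiky" by (simp add: one_periodic_def spiky_def spikes_periodic)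
  have b: "spiky \<in> borel_measurable borel" unfolding spiky_def[abs_def] by measurable
  then show "spiky \<in> borel_measurable torus_measure" by (rule borel_measurable_torus)
  show "integrable torus_measure (\<lambda>x. norm (spiky x) powr p)"
  proof (rule integrable_dominated)
    show "integrable torus_measure (\<lambda>x. spikes 0 x powr p + spike_mean powr p)"
      using integrable_spikes_powr[OF p] by simp
    show "(\<lambda>x. norm (spiky x) powr p) \<in> borel_measurable torus_measure"
      using b by (intro borel_measurable_torus) measurable
    fix x
    have "norm (spiky x) \<le> max (spikes 0 x) spike_mean"
      using spikes_nonneg[of 0 x] spike_mean_nonneg by (auto simp: spiky_def)
    then have "norm (spiky x) powr p \<le> (max (spikes 0 x) spike_mean) powr p"
      using p by (intro powr_mono2) auto
    also have "\<dots> \<le> spikes 0 x powr p + spike_mean powr p" by (simp add: max_def)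
    finally show "norm (norm (spiky x) powr p) \<le> spikes 0 x powr p + spike_mean powr p" by simp
  qed
qed

text \<open>Finiteness excludes the default value: with infinitely many spikes,
  \<open>spikes 0 x\<close> and \<open>spikes K x\<close> are both 0 while the finite sum may be
  positive.\<close>

lemma spikes_split:
  assumes fin: "finite {k. x \<in> rare k}"
  shows "spikes 0 x = (\<Sum>k<K. height k * indicator (rare k) x) + spikes K x"
proof -
  let ?S = "{k. x \<in> rare k}"
  have "spikes 0 x = sum height (?S \<inter> {..<K} \<union> (+) K ` {j. x \<in> rare (K + j)})"
  proof -
    have "?S = ?S \<inter> {..<K} \<union> (+) K ` {j. x \<in> rare (K + j)}"
      by (auto simp: image_iff) (metis le_add_diff_inverse not_less)
    then show ?thesis by (simp add: spikes_def)
  qed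
  also have "\<dots> = sum height (?S \<inter> {..<K}) + sum height ((+) K ` {j. x \<in> rare (K + j)})"
    using finite_subset[OF _ fin, of "(+) K ` {j. x \<in> rare (K + j)}"]
    by (intro sum.union_disjoint) auto
  also have "sum height ((+) K ` {j. x \<in> rare (K + j)}) = spikes K x"
    by (subst sum.reindex) (auto simp: spikes_def)
  also have "sum height (?S \<inter> {..<K}) = (\<Sum>k<K. height k * indicator (rare k) x)"
  proof -
    have "sum height (?S \<inter> {..<K}) = (\<Sum>k<K. if k \<in> ?S then height k else 0)"
      by (subst Int_commute) (rule sum.inter_restrict, simp)
    also have "\<dots> = (\<Sum>k<K. height k * indicator (rare k) x)" by (rule sum.cong) auto
    finally show ?thesis .
  qed
  finally show ?thesis .
qed

section \<open>Fourier tail of the spike function\<close>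

lemma depth_mono: "k \<le> l \<Longrightarrow> depth k \<le> depth l"
  unfolding depth_def width_def blocks_def
  by (intro mult_le_mono add_le_mono power_increasing floor_log_le_iff) auto

text \<open>The 4 lets \<open>2 ^ depth (K - 1)\<close> absorb three factors 2^K in the tail
  estimate and still leave 2^-K.\<close>

lemma depth_ge: "4 * Suc k \<le> depth k"
proof -
  have "Suc k \<le> width k" by (simp add: width_def trans_le_add1 Suc_leI less_le_trans[OF less_exp])
  moreover have "4 \<le> blocks k"
  proof -
    have "(2::nat) ^ 2 \<le> 2 ^ 2 ^ (k + 1)" by (intro power_increasing) auto
    then show ?thesis by (simp add: blocks_def)
  qed
  ultimately have "Suc k * 4 \<le> depth k" unfolding depth_def by (rule mult_le_mono)
  then show ?thesis by simp
qed

text \<open>\<open>width k\<close> is at most \<open>blocks k\<close>, so \<open>depth k\<close> is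
  at most the square of \<open>blocks k\<close>; this gives the double logarithm of the resolution
  the order 2^k.\<close>

lemma depth_le: "depth k \<le> 2 ^ 2 ^ (k + 2)"
proof -
  have fl: "floor_log (k + 1) \<le> k"
    using floor_log_le_iff[of "k + 1" "2 ^ k"] less_exp[of k] by simp
  have 1: "k + 2 \<le> 2 ^ (k + 1)" using less_exp[of "k + 1"] by (simp add: Suc_leI)
  have "k < 2 ^ k" by (rule less_exp)
  with fl have "k + floor_log (k + 1) \<le> 2 ^ (k + 1)" unfolding power_add power_one_right by linarith
  then have "width k \<le> 2 ^ (k + 1) + 2 ^ (k + 1)" unfolding width_def by linarith
  also have "\<dots> = 2 ^ (k + 2)" by simp
  also have "\<dots> \<le> 2 ^ 2 ^ (k + 1)" using 1 by (intro power_increasing) auto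
  finally have "depth k \<le> 2 ^ 2 ^ (k + 1) * 2 ^ 2 ^ (k + 1)" unfolding depth_def blocks_def by (rule mult_le_mono1)
  also have "\<dots> = 2 ^ (2 ^ (k + 1) + 2 ^ (k + 1))" by (simp only: power_add)
  also have "(2::nat) ^ (k + 1) + 2 ^ (k + 1) = 2 ^ (k + 2)" by simp
  finally show ?thesis .
qed

text \<open>With d = \<open>depth (K - 1)\<close> and N at least 8^d, the dyadic bound 4^d / N is at
  most 2^-d. Three factors K + 1, from the squared heights, the number of summands and
  Cauchy-Schwarz, are absorbed by \<open>depth_ge\<close>.\<close>

lemma tail_energy_truncated:
  assumes N: "8 ^ depth (K - 1) \<le> N" and K: "K \<ge> 1"
  shows "sq_integrable (\<lambda>x. complex_of_real ((\<Sum>k<K. height k * indicator (rare k) x) - spike_mean))"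
    and "tail_energy N (\<lambda>x. complex_of_real ((\<Sum>k<K. height k * indicator (rare k) x) - spike_mean)) \<le> 1 / 2 ^ K"
proof -
  define F where "F k = (if k < K then (\<lambda>x. complex_of_real (height k) * complex_of_real (indicator (rare k) x))
      else (\<lambda>x. complex_of_real (- spike_mean)))" for k
  have sq: "sq_integrable (F k)" for k
    unfolding F_def using sq_integrable_cmult[OF sq_integrable_indicator[OF rare_borel]] sq_integrable_const by simp
  have eq: "(\<lambda>x. complex_of_real ((\<Sum>k<K. height k * indicator (rare k) x) - spike_mean)) = (\<lambda>x. \<Sum>k<Suc K. F k x)"
  proof
    fix x
    have "(\<Sum>k<K. F k x) = (\<Sum>k<K. complex_of_real (height k * indicator (rare k) x))"
      by (rule sum.cong) (simp_all add: F_def)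
    then show "complex_of_real ((\<Sum>k<K. height k * indicator (rare k) x) - spike_mean) = (\<Sum>k<Suc K. F k x)"
      unfolding sum.lessThan_Suc of_real_diff of_real_sum by (simp add: F_def)
  qed
  show "sq_integrable (\<lambda>x. complex_of_real ((\<Sum>k<K. height k * indicator (rare k) x) - spike_mean))"
    unfolding eq by (rule sq_integrable_sum) (auto simp: sq)
  define d where "d = depth (K - 1)"
  have N8: "8 ^ d \<le> real N" using N unfolding d_def by (metis of_nat_le_iff of_nat_numeral of_nat_power)
  have N0: "N > 0" using N by (metis gr0I le_zero_eq power_not_zero zero_neq_numeral)
  have tF: "tail_energy N (F k) \<le> real (Suc K) * (1 / 2 ^ d)" for k
  proof (cases "k < K")
    case True
    have "tail_energy N (F k) = (height k)\<^sup>2 * tail_energy N (\<lambda>x. complex_of_real (indicator (rare k) x))"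
      using True by (simp add: F_def tail_energy_cmult)
    also have "\<dots> \<le> real (Suc K) * (1 / 2 ^ d)"
    proof (rule mult_mono)
      show "(height k)\<^sup>2 \<le> real (Suc K)" unfolding height_sq using True by simp
      have "tail_energy N (\<lambda>x. complex_of_real (indicator (rare k) x)) \<le> 4 ^ depth k / real N"
        by (rule tail_energy_dyadic[OF dyadic_rare N0])
      also have "\<dots> \<le> 4 ^ d / real N"
        using True depth_mono[of k "K - 1"] unfolding d_def by (intro divide_right_mono power_increasing) auto
      also have "\<dots> \<le> 4 ^ d / 8 ^ d" using N8 by (intro divide_left_mono) (use N0 in auto)
      also have "\<dots> = 1 / 2 ^ d"
      proof -
        have "(8::real) ^ d = 4 ^ d * 2 ^ d" by (simp add: power_mult_distrib[symmetric])
        then show ?thesis by simp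
      qed
      finally show "tail_energy N (\<lambda>x. complex_of_real (indicator (rare k) x)) \<le> 1 / 2 ^ d" .
    qed (auto simp: tail_energy_def)
    finally show ?thesis .
  next
    case False
    then show ?thesis by (simp add: F_def tail_energy_const del: of_real_minus of_nat_Suc)
  qed
  have "tail_energy N (\<lambda>x. \<Sum>k<Suc K. F k x) \<le> real (card {..<Suc K}) * (\<Sum>k<Suc K. tail_energy N (F k))"
    by (rule tail_energy_sum) (auto simp: sq)
  also have "\<dots> \<le> real (card {..<Suc K}) * (\<Sum>k<Suc K. real (Suc K) * (1 / 2 ^ d))"
    by (intro mult_left_mono sum_mono tF) simp
  also have "\<dots> = real (Suc K) ^ 3 / 2 ^ d" by (simp add: power3_eq_cube del: of_nat_Suc)
  also have "\<dots> \<le> (2 ^ K) ^ 3 / 2 ^ d"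
  proof (intro divide_right_mono power_mono)
    have "Suc K \<le> 2 ^ K" by (rule Suc_leI[OF less_exp])
    then show "real (Suc K) \<le> 2 ^ K" by (metis of_nat_le_iff of_nat_numeral of_nat_power)
  qed auto
  also have "\<dots> \<le> (2 ^ K) ^ 3 / 2 ^ (4 * K)"
    using depth_ge[of "K - 1"] K unfolding d_def by (intro divide_left_mono power_increasing) auto
  also have "\<dots> = 1 / 2 ^ K"
  proof -
    have "(2::real) ^ (4 * K) = (2 ^ K) ^ 3 * 2 ^ K" by (simp add: power_mult[symmetric] power_add[symmetric])
    then show ?thesis by simp
  qed
  finally show "tail_energy N (\<lambda>x. complex_of_real ((\<Sum>k<K. height k * indicator (rare k) x) - spike_mean)) \<le> 1 / 2 ^ K"
    unfolding eq .
qed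

text \<open>The spikes below level K are resolved by the frequencies up to N; those from level K on
  are small in L^2 as a whole.\<close>

lemma tail_energy_spiky:
  assumes N: "8 ^ depth (K - 1) \<le> N" and K: "K \<ge> 1"
  shows "tail_energy N (\<lambda>x. complex_of_real (spiky x)) \<le> 2 * (1 + spike_const) / 2 ^ K"
proof -
  let ?h = "\<lambda>x. complex_of_real ((\<Sum>k<K. height k * indicator (rare k) x) - spike_mean)"
  define F where "F i = (if i = 0 then ?h else (\<lambda>x. complex_of_real (spikes K x)))" for i :: nat
  have sq: "sq_integrable (F i)" for i
    unfolding F_def using tail_energy_truncated(1)[OF N K] sq_integrable_spikes by simp
  have sum2: "(\<Sum>i<2. G i) = G 0 + G 1" for G :: "nat \<Rightarrow> 'a::comm_monoid_add"
    by (simp add: numeral_2_eq_2)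
  have "tail_energy N (\<lambda>x. complex_of_real (spiky x)) = tail_energy N (\<lambda>x. \<Sum>i<2. F i x)"
  proof (rule tail_energy_cong_AE)
    show "(\<lambda>x. complex_of_real (spiky x)) \<in> borel_measurable torus_measure"
      unfolding spiky_def by (intro borel_measurable_torus) measurable
    show "(\<lambda>x. \<Sum>i<2. F i x) \<in> borel_measurable torus_measure"
      using sq by (intro borel_measurable_sum) (auto simp: sq_integrable_def)
    show "AE x in torus_measure. complex_of_real (spiky x) = (\<Sum>i<2. F i x)"
      using AE_finite_rare[of 0]
    proof (rule AE_mp, intro AE_I2 impI)
      fix x assume "finite {k. 2 ^ 0 * x \<in> rare k}"
      then have "spikes 0 x = (\<Sum>k<K. height k * indicator (rare k) x) + spikes K x"
        by (intro spikes_split) simp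
      then show "complex_of_real (spiky x) = (\<Sum>i<2. F i x)"
        unfolding sum2 by (simp add: F_def spiky_def)
    qed
  qed
  also have "\<dots> \<le> real (card {..<2::nat}) * (\<Sum>i<2. tail_energy N (F i))"
    by (rule tail_energy_sum) (auto simp: sq)
  also have "\<dots> = 2 * (tail_energy N ?h + tail_energy N (\<lambda>x. complex_of_real (spikes K x)))"
    unfolding sum2 by (simp add: F_def)
  also have "\<dots> \<le> 2 * (1 / 2 ^ K + spike_const / 2 ^ K)"
  proof (intro mult_left_mono add_mono)
    show "tail_energy N ?h \<le> 1 / 2 ^ K" by (rule tail_energy_truncated(2)[OF N K])
    have "tail_energy N (\<lambda>x. complex_of_real (spikes K x)) \<le> (LINT x|torus_measure. (norm (complex_of_real (spikes K x)))\<^sup>2)"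
      by (rule tail_energy_le[OF sq_integrable_spikes])
    also have "\<dots> \<le> spike_const / 2 ^ K" using spikes_square(2)[of K] by simp
    finally show "tail_energy N (\<lambda>x. complex_of_real (spikes K x)) \<le> spike_const / 2 ^ K" .
  qed simp
  also have "\<dots> = 2 * (1 + spike_const) / 2 ^ K" by (simp add: add_divide_distrib)
  finally show ?thesis .
qed

lemma ln_ln_le:
  assumes "N < 8 ^ depth K" "N \<ge> 4"
  shows "ln (ln (real N)) \<le> 8 * 2 ^ K" "ln (ln (real N)) > 0"
proof -
  have l1: "ln (real N) > 1"
  proof -
    \<comment> \<open>Here \<open>exp_le\<close> bounds \<open>exp 1\<close> by 3, hence the
      threshold 4 for a positive double logarithm.\<close>
    have "exp 1 < real N" using exp_le assms(2) by linarith
    then have "ln (exp 1) < ln (real N)" using assms(2) by (subst ln_less_cancel_iff) auto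
    then show ?thesis by simp
  qed
  then show "ln (ln (real N)) > 0" by simp
  have "real N \<le> real (8 ^ depth K)" using assms(1) by (simp only: of_nat_le_iff less_imp_le)
  then have "ln (real N) \<le> ln (8 ^ depth K)" using assms(2) by (subst ln_le_cancel_iff) auto
  also have "\<dots> = real (depth K) * ln 8" by (simp add: ln_realpow)
  also have "\<dots> \<le> 2 ^ 2 ^ (K + 2) * 2 ^ 3"
  proof (rule mult_mono)
    show "real (depth K) \<le> 2 ^ 2 ^ (K + 2)" using depth_le[of K] by (metis of_nat_le_iff of_nat_numeral of_nat_power)
    show "ln (8::real) \<le> 2 ^ 3" using ln_bound[of 8] by simp
  qed auto
  also have "\<dots> = (2::real) ^ (2 ^ (K + 2) + 3)" by (simp only: power_add)
  finally have "ln (ln (real N)) \<le> ln ((2::real) ^ (2 ^ (K + 2) + 3))" using l1 by (subst ln_le_cancel_iff) auto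
  also have "\<dots> = real (2 ^ (K + 2) + 3) * ln 2" by (rule ln_realpow)
  also have "\<dots> \<le> real (2 ^ (K + 2) + 3) * 1" by (rule mult_left_mono) (use ln_2_less_1 in simp_all)
  also have "\<dots> \<le> 8 * 2 ^ K"
  proof -
    have "(1::real) \<le> 2 ^ K" by simp
    moreover have "real (2 ^ (K + 2) + 3) * 1 = 4 * 2 ^ K + 3" by (simp add: power_add)
    ultimately show ?thesis by linarith
  qed
  finally show "ln (ln (real N)) \<le> 8 * 2 ^ K" .
qed

lemma L2_tail_spiky:
  "\<exists>C>0. \<forall>\<^sub>F N in sequentially.
     L2_norm (\<lambda>x. complex_of_real (spiky x) - fourier_partial_sum N (\<lambda>y. complex_of_real (spiky y)) x)
       \<le> C * (ln (ln (real N))) powr (- 1 / 2)"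
proof (intro exI conjI)
  \<comment> \<open>The 16 is the 2 of \<open>tail_energy_spiky\<close> times the 8 of
    \<open>ln_ln_le\<close>.\<close>
  let ?C = "sqrt (16 * (1 + spike_const))"
  show "?C > 0" using spike_const_nonneg by simp
  show "\<forall>\<^sub>F N in sequentially.
     L2_norm (\<lambda>x. complex_of_real (spiky x) - fourier_partial_sum N (\<lambda>y. complex_of_real (spiky y)) x)
       \<le> ?C * (ln (ln (real N))) powr (- 1 / 2)"
    unfolding eventually_sequentially
  proof (intro exI allI impI)
    \<comment> \<open>The first summand of the threshold forces \<open>K \<ge> 1\<close>, the second
      makes the double logarithm positive.\<close>
    fix N :: nat assume N: "8 ^ depth 0 + 4 \<le> N"
    \<comment> \<open>This puts N between \<open>8 ^ depth (K - 1)\<close> and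
      \<open>8 ^ depth K\<close>: the lower bound feeds the tail estimate, the upper one compares
      2^K with the double logarithm.\<close>
    define K where "K = (LEAST k. N < 8 ^ depth k)"
    have "N < 8 ^ depth N"
    proof -
      have "N \<le> depth N" using depth_ge[of N] by simp
      then have "N < 2 ^ depth N" using less_exp[of "depth N"] by linarith
      also have "\<dots> \<le> 8 ^ depth N" by (rule power_mono) auto
      finally show ?thesis .
    qed
    then have K: "N < 8 ^ depth K" unfolding K_def by (rule LeastI)
    have K1: "K \<ge> 1"
    proof (rule ccontr)
      assume "\<not> K \<ge> 1" then have "K = 0" by simp
      then show False using K N by simp
    qed
    have NK: "8 ^ depth (K - 1) \<le> N"
    proof (rule ccontr)
      assume "\<not> 8 ^ depth (K - 1) \<le> N"
      then have "K \<le> K - 1" unfolding K_def by (intro Least_le) (simp add: K_def not_le)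
      then show False using K1 by simp
    qed
    define l where "l = ln (ln (real N))"
    have l: "l \<le> 8 * 2 ^ K" "l > 0" using ln_ln_le[OF K] N by (auto simp: l_def)
    have "tail_energy N (\<lambda>x. complex_of_real (spiky x)) \<le> 2 * (1 + spike_const) / 2 ^ K"
      by (rule tail_energy_spiky[OF NK K1])
    also have "\<dots> = 16 * (1 + spike_const) / (8 * 2 ^ K)" by (simp add: field_simps)
    also have "\<dots> \<le> 16 * (1 + spike_const) / l"
      using l spike_const_nonneg by (intro divide_left_mono) auto
    finally have "sqrt (tail_energy N (\<lambda>x. complex_of_real (spiky x))) \<le> sqrt (16 * (1 + spike_const) / l)"
      by (rule real_sqrt_le_mono)
    also have "\<dots> = ?C * l powr (- 1 / 2)"
    proof -
      have "l powr (- 1 / 2) = 1 / sqrt l"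
        using l(2) by (simp add: powr_minus_divide powr_half_sqrt)
      then show ?thesis by (simp only: real_sqrt_divide) simp
    qed
    finally show "L2_norm (\<lambda>x. complex_of_real (spiky x) - fourier_partial_sum N (\<lambda>y. complex_of_real (spiky y)) x)
       \<le> ?C * (ln (ln (real N))) powr (- 1 / 2)"
      by (simp add: L2_norm_def tail_energy_def l_def)
  qed
qed

section \<open>The lacunary sequence\<close>

definition epoch :: "nat \<Rightarrow> nat" where
  "epoch r = floor_log (r + 1)"

text \<open>Stage r owns the digits from \<open>start r\<close> to \<open>start (Suc r)\<close>,
  exactly one window of \<open>rare (epoch r)\<close>; this keeps the stages independent.\<close>

primrec start :: "nat \<Rightarrow> nat" where
  "start 0 = 0"
| "start (Suc r) = start r + depth (epoch r)"

text \<open>The ranges are 2^r < j <= 2^(r+1), hence the \<open>j - 1\<close>; each further j of a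
  stage shifts by one more block. For j = 1, \<open>floor_log 0\<close> is 0 and so is the
  exponent.\<close>

definition exponent :: "nat \<Rightarrow> nat" where
  "exponent j = (let r = floor_log (j - 1) in start r + width (epoch r) * (j - 2 ^ r))"

lemma exponent_eq:
  assumes "2 ^ r < j" "j \<le> 2 ^ Suc r"
  shows "exponent j = start r + width (epoch r) * (j - 2 ^ r)"
proof -
  have "floor_log (j - 1) = r" using assms by (intro floor_log_eqI) auto
  then show ?thesis by (simp add: exponent_def)
qed

lemma width_pos: "width k > 0"
  by (simp add: width_def)

text \<open>This dictates the size of M_k: shifts by up to 2^r blocks have to fit into half of the
  window for every r of the level.\<close>

lemma blocks_ge: "2 * 2 ^ r \<le> blocks (epoch r)"
proof -
  have "r + 1 \<le> 2 ^ (epoch r + 1)"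
    using floor_log_exp2_ge[of "r + 1"] by (simp add: epoch_def)
  then have "(2::nat) ^ (r + 1) \<le> 2 ^ 2 ^ (epoch r + 1)" by (rule power_increasing) simp
  then show ?thesis by (simp add: blocks_def)
qed

lemma blocks_even: "2 * (blocks k div 2) = blocks k"
  by (simp add: blocks_def)

lemma exponent_strict:
  assumes "j \<ge> 1" shows "exponent j < exponent (Suc j)"
proof (cases "j = 1")
  case True
  have "exponent 1 = 0" by (simp add: exponent_def)
  moreover have "exponent (Suc 1) = start 0 + width (epoch 0) * (Suc 1 - 2 ^ 0)"
    by (rule exponent_eq) auto
  ultimately show ?thesis using True width_pos by simp
next
  case False
  define r where "r = floor_log (j - 1)"
  have j: "2 ^ r < j" "j \<le> 2 ^ Suc r"
    using floor_log_exp2_le[of "j - 1"] floor_log_exp2_gt[of "j - 1"] False assms by (auto simp: r_def)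
  note ej = exponent_eq[OF j]
  show ?thesis
  proof (cases "j < 2 ^ Suc r")
    case True
    have "exponent (Suc j) = start r + width (epoch r) * (Suc j - 2 ^ r)"
      using j True by (intro exponent_eq) auto
    moreover have "width (epoch r) * (j - 2 ^ r) < width (epoch r) * (Suc j - 2 ^ r)"
      using width_pos j by (intro mult_less_mono2) auto
    ultimately show ?thesis using ej by simp
  next
    case False
    \<comment> \<open>At the seam between stages, the last exponent of stage r is at most
      \<open>start (Suc r)\<close>, and the next one lies strictly beyond it.\<close>
    then have je: "j = 2 ^ Suc r" using j by simp
    have "exponent (Suc j) = start (Suc r) + width (epoch (Suc r)) * (Suc j - 2 ^ Suc r)"
      using je by (intro exponent_eq) auto
    then have "exponent (Suc j) = start r + depth (epoch r) + width (epoch (Suc r))" using je by simp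
    moreover have "width (epoch r) * (j - 2 ^ r) \<le> depth (epoch r)"
      unfolding depth_def using je blocks_ge[of r] by (intro mult_le_mono2) simp
    ultimately show ?thesis using ej width_pos[of "epoch (Suc r)"] by simp
  qed
qed

section \<open>Almost sure hits and unbounded averages\<close>

definition hit :: "nat \<Rightarrow> real set" where
  "hit r = (\<Union>i<blocks (epoch r) div 2.
     zero_block (start r + width (epoch r) * (blocks (epoch r) div 2) + width (epoch r) * i) (width (epoch r)))"

text \<open>The zero digit sits in the second half of the window of \<open>rare\<close>, so it is still
  inside the window after a shift by at most half of its length.\<close>

lemma hit_rare:
  assumes x: "x \<in> hit r" and j: "2 ^ r < j" "j \<le> 2 ^ Suc r"
  shows "2 ^ exponent j * x \<in> rare (epoch r)"
proof -
  define k where "k = epoch r"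
  define h where "h = blocks k div 2"
  obtain i where i: "i < h" "x \<in> zero_block (start r + width k * h + width k * i) (width k)"
    using x by (auto simp: hit_def k_def h_def)
  define l where "l = j - 2 ^ r"
  have "2 ^ r \<le> h" using blocks_ge[of r] blocks_even[of k] unfolding h_def k_def by linarith
  then have l: "l \<le> h" using j by (simp add: l_def)
  have b: "blocks k = h + h" using blocks_even[of k] by (simp add: h_def)
  \<comment> \<open>The shift by l blocks moves block \<open>h + i\<close> of the stage to place
    \<open>h + i - l\<close> of the window; the subtraction is not truncated, since
    \<open>l \<le> h\<close>.\<close>
  have e: "width k * (h + i - l) + (start r + width k * l) = start r + width k * h + width k * i"
  proof -
    have "width k * (h + i - l) + width k * l = width k * (h + i)"
      using l by (simp add: distrib_left[symmetric])
    then show ?thesis by (simp add: distrib_left)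
  qed
  have "2 ^ (start r + width k * l) * x \<in> zero_block (width k * (h + i - l)) (width k)"
    unfolding power2_mult_in_zero_block e by (rule i(2))
  moreover have "h + i - l < blocks k" using i(1) l b by simp
  ultimately show ?thesis
    unfolding exponent_eq[OF j] rare_def k_def[symmetric] l_def[symmetric] by blast
qed

text \<open>The probabilities are constant on each level, which suits Cauchy condensation: the
  condensed terms are 1/2^floor_log(n+1), at least 1/(n+1). Using only half of the blocks merely
  halves the series.\<close>

lemma AE_infinitely_many_hits: "AE x in torus_measure. \<exists>\<^sub>\<infinity>r. x \<in> hit r"
  unfolding hit_def
proof (rule AE_infinitely_many_zero_blocks)
  fix r
  let ?w = "width (epoch r)" and ?b = "blocks (epoch r) div 2"
  \<comment> \<open>The blocks of \<open>hit r\<close> fill the second half of the window and end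
    exactly at \<open>start (Suc r)\<close>.\<close>
  have "?w * ?b + ?w * ?b = depth (epoch r)"
    unfolding depth_def by (simp add: distrib_left[symmetric] mult_2[symmetric] blocks_even)
  then show "start r + ?w * ?b + ?w * ?b \<le> start (Suc r) + width (epoch (Suc r)) * (blocks (epoch (Suc r)) div 2)"
    by simp
next
  \<comment> \<open>Indexed by t = r + 1, so that \<open>epoch r\<close> becomes
    \<open>floor_log t\<close> and condensation at t = 2^n picks one value per level.\<close>
  define g :: "nat \<Rightarrow> real" where "g t = 1 / (2 ^ floor_log t * 2 ^ floor_log (floor_log t + 1))" for t
  have gr: "real (blocks (epoch r) div 2) / 2 ^ width (epoch r) = 1 / 2 * g (r + 1)" for r
  proof -
    have "real (blocks (epoch r)) = 2 * real (blocks (epoch r) div 2)"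
      using blocks_even[of "epoch r"] by (metis of_nat_mult of_nat_numeral)
    then have "real (blocks (epoch r) div 2) / 2 ^ width (epoch r) = 1 / 2 * (real (blocks (epoch r)) / 2 ^ width (epoch r))"
      by simp
    then show ?thesis unfolding blocks_div_width by (simp add: g_def epoch_def)
  qed
  have "\<not> summable g"
  proof
    assume "summable g"
    moreover have "g (Suc m) \<le> g m" for m
    proof -
      have "floor_log m \<le> floor_log (Suc m)" by (rule floor_log_le_iff) simp
      moreover from this have "floor_log (floor_log m + 1) \<le> floor_log (floor_log (Suc m) + 1)"
        by (intro floor_log_le_iff) simp
      ultimately show ?thesis unfolding g_def by (intro divide_left_mono mult_mono power_increasing) auto
    qed
    ultimately have s: "summable (\<lambda>n. 2 ^ n * g (2 ^ n))"
      by (subst (asm) condensation_test) (auto simp: g_def)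
    have "summable (\<lambda>n. inverse (real (Suc n)))"
    proof (rule summable_comparison_test'[OF s, of 0])
      fix n
      have "real (2 ^ floor_log (n + 1)) \<le> real (n + 1)"
        by (simp only: of_nat_le_iff) (rule floor_log_exp2_le, simp)
      then have "inverse (real (n + 1)) \<le> inverse (2 ^ floor_log (n + 1))" by (intro le_imp_inverse_le) auto
      also have "\<dots> = 2 ^ n * g (2 ^ n)" by (simp add: g_def inverse_eq_divide)
      finally show "norm (inverse (real (Suc n))) \<le> 2 ^ n * g (2 ^ n)" by simp
    qed
    then have "summable (\<lambda>n. inverse (real n))" by (subst (asm) summable_Suc_iff)
    then show False using not_summable_harmonic[where 'a=real] by simp
  qed
  then have "\<not> summable (\<lambda>r. g (r + 1))" using summable_Suc_iff[of g] by simp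
  then show "\<not> summable (\<lambda>r. real (blocks (epoch r) div 2) / 2 ^ width (epoch r))"
    unfolding gr using summable_cmult_iff[of "1 / 2 :: real" "\<lambda>r. g (r + 1)"] by simp
qed

text \<open>The second half of the 2^(r+1) terms see the spike, and the first half are bounded below
  by \<open>spiky_ge\<close>; so half of the height survives.\<close>

lemma average_ge:
  assumes x: "x \<in> hit r" and fin: "\<And>j. finite {k. 2 ^ exponent j * x \<in> rare k}"
  shows "1 / real (2 ^ Suc r) * (\<Sum>j = 1..2 ^ Suc r. spiky (real (2 ^ exponent j) * x))
    \<ge> height (epoch r) / 2 - spike_mean"
proof -
  let ?f = "\<lambda>j. spiky (real (2 ^ exponent j) * x)"
  have "real (2 ^ r) * height (epoch r) - real (2 ^ Suc r) * spike_mean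
      = (\<Sum>j = 1..2 ^ Suc r. (if (2::nat) ^ r < j then height (epoch r) else 0) - spike_mean)"
  proof -
    have "{j \<in> {1..2 ^ Suc r}. (2::nat) ^ r < j} = {2 ^ r<..2 ^ Suc r}" by auto
    then have "(\<Sum>j = 1..2 ^ Suc r. if (2::nat) ^ r < j then height (epoch r) else 0) = real (2 ^ r) * height (epoch r)"
      by (subst sum.inter_filter[symmetric]) simp_all
    then show ?thesis by (simp add: sum_subtractf)
  qed
  also have "\<dots> \<le> (\<Sum>j = 1..2 ^ Suc r. ?f j)"
  proof (rule sum_mono)
    fix j :: nat assume j: "j \<in> {1..2 ^ Suc r}"
    show "(if 2 ^ r < j then height (epoch r) else 0) - spike_mean \<le> ?f j"
    proof (cases "2 ^ r < j")
      case True
      let ?y = "2 ^ exponent j * x"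
      have "epoch r \<in> {k. ?y \<in> rare k}" using hit_rare[OF x True] j by simp
      then have "height (epoch r) \<le> spikes 0 ?y"
        unfolding spikes_def using fin[of j] by (simp, intro member_le_sum) (auto simp: height_def)
      then show ?thesis using True by (simp add: spiky_def)
    next
      case False
      then show ?thesis using spiky_ge by simp
    qed
  qed
  finally have "(real (2 ^ r) * height (epoch r) - real (2 ^ Suc r) * spike_mean) / real (2 ^ Suc r)
      \<le> (\<Sum>j = 1..2 ^ Suc r. ?f j) / real (2 ^ Suc r)"
    by (rule divide_right_mono) simp
  then show ?thesis by (simp add: diff_divide_distrib)
qed

lemma height_epoch_unbounded: "\<exists>R. \<forall>r\<ge>R. height (epoch r) \<ge> B"
proof -
  obtain k where k: "B\<^sup>2 \<le> real k" using real_arch_simple by blast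
  have "B \<le> height (epoch r)" if "r \<ge> 2 ^ k" for r
  proof -
    have "k = floor_log (2 ^ k)" by simp
    also have "\<dots> \<le> epoch r" unfolding epoch_def using that by (intro floor_log_le_iff) simp
    finally have "height k \<le> height (epoch r)" by (rule height_mono)
    moreover have "B \<le> height k" unfolding height_def by (rule real_le_rsqrt) (use k in simp)
    ultimately show ?thesis by linarith
  qed
  then show ?thesis by blast
qed

text \<open>Hits occur for arbitrarily large r, and each makes the average over 2^(r+1) terms at
  least half an unbounded height minus a constant. Only countably many dilations have to avoid
  infinitely many spikes, so one null set covers them all.\<close>

lemma limsup_averages:
  "AE x in torus_measure.
     limsup (\<lambda>N. ereal (1 / real N * (\<Sum>j = 1..N. spiky (real (2 ^ exponent j) * x)))) = \<infinity>"
proof -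
  have "AE x in torus_measure. \<forall>j. finite {k. 2 ^ exponent j * x \<in> rare k}"
    using AE_finite_rare by (simp add: AE_all_countable)
  with AE_infinitely_many_hits show ?thesis
  proof eventually_elim
    case (elim x)
    let ?u = "\<lambda>N. 1 / real N * (\<Sum>j = 1..N. spiky (real (2 ^ exponent j) * x))"
    have "(SUP N\<in>{n..}. ereal (?u N)) = \<infinity>" for n
    proof -
      have "ereal B \<le> (SUP N\<in>{n..}. ereal (?u N))" for B
      proof -
        obtain R where R: "\<And>r. r \<ge> R \<Longrightarrow> height (epoch r) \<ge> 2 * (B + spike_mean)"
          using height_epoch_unbounded by blast
        obtain r where r: "r \<ge> max R n" "x \<in> hit r" using elim(1) unfolding INFM_nat_le by blast
        have "B \<le> height (epoch r) / 2 - spike_mean" using R[of r] r(1) by simp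
        also have "\<dots> \<le> ?u (2 ^ Suc r)" using average_ge[OF r(2)] elim(2) by blast
        finally have "ereal B \<le> ereal (?u (2 ^ Suc r))" by simp
        also have "\<dots> \<le> (SUP N\<in>{n..}. ereal (?u N))"
        proof (rule SUP_upper)
          have "r < 2 ^ r" by (rule less_exp)
          then have "r < 2 ^ Suc r" unfolding power_Suc by linarith
          then show "2 ^ Suc r \<in> {n..}" using r(1) by simp
        qed
        finally show ?thesis .
      qed
      then show ?thesis by (rule ereal_top)
    qed
    then show ?case unfolding limsup_INF_SUP by simp
  qed
qed

theorem theorem1p1:
  "\<exists>(f :: real \<Rightarrow> real) (n :: nat \<Rightarrow> nat).
     (\<forall>p::real. 1 \<le> p \<longrightarrow> in_Lp p f) \<and>
     (LINT x|torus_measure. f x) = 0 \<and>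
     (\<forall>j\<ge>1. 0 < n j) \<and>
     (\<forall>j\<ge>1. n j < n (Suc j)) \<and>
     (\<forall>j\<ge>1. 2 \<le> real (n (Suc j)) / real (n j)) \<and>
     (\<exists>C>0. \<forall>\<^sub>F N in sequentially.
        L2_norm (\<lambda>x. complex_of_real (f x) - fourier_partial_sum N (\<lambda>y. complex_of_real (f y)) x)
          \<le> C * (ln (ln (real N))) powr (- 1 / 2)) \<and>
     (AE x in torus_measure.
        limsup (\<lambda>N. ereal (1 / real N * (\<Sum>j = 1..N. f (real (n j) * x)))) = \<infinity>)"
proof (rule exI[of _ spiky], rule exI[of _ "\<lambda>j. 2 ^ exponent j"], intro conjI)
  show "\<forall>p\<ge>1. in_Lp p spiky" by (simp add: spiky_in_Lp)
  show "(LINT x|torus_measure. spiky x) = 0" by (rule integral_spiky)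
  show "\<forall>j\<ge>1. 0 < (2::nat) ^ exponent j" by simp
  show "\<forall>j\<ge>1. (2::nat) ^ exponent j < 2 ^ exponent (Suc j)" using exponent_strict by simp
  show "\<forall>j\<ge>1. 2 \<le> real (2 ^ exponent (Suc j)) / real (2 ^ exponent j)"
  proof (intro allI impI)
    fix j :: nat assume "1 \<le> j"
    then have "(2::real) ^ Suc (exponent j) \<le> 2 ^ exponent (Suc j)"
      by (intro power_increasing) (use exponent_strict in \<open>auto simp: Suc_le_eq\<close>)
    then show "2 \<le> real (2 ^ exponent (Suc j)) / real (2 ^ exponent j)" by (simp add: le_divide_eq)
  qed
qed (rule L2_tail_spiky limsup_averages)+

end
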